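(* Let $G$ be a second countable locally compact group, $H$ a closed subgroup of $G$, and let $L=\bigcap_{g\in G} gHg^{-1}$. Assume that there exists a proper $G$-invariant compatible metric on $G/H$. Then (i) there exists a non-zero relatively $G$-invariant (positive Radon) measure on $G/H$; (ii) $H/L$ is maximally almost periodic; (iii) $H$ is topologically almost normal in $G$.
   Context: All topological spaces and topological groups are Hausdorff. For a closed subgroup $H$ of a topological group $G$, the coset space $G/H=\{gH : g\in G\}$ carries the quotient topology, and $G$ acts on it by left translation. A compatible metric on a topological space is a metric inducing its topology. A metric $d$ on $G/H$ is $G$-invariant if $d(gx,gy)=d(x,y)$ for all $g\in G$ and $x,y\in G/H$. A metric is proper if all its closed balls $\{y : d(x,y)\le r\}$ are compact. A positive Radon measure $\mu$ on $G/H$ is relatively $G$-invariant if there is a continuous homomorphism $\chi: G\to (0,\infty)$ (multiplicative group) such that $\mu(gA)=\chi(g)\mu(A)$ for every $g\in G$ and every Borel set $A\subset G/H$. A topological group is maximally almost periodic if there exists a continuous injective homomorphism from it into a compact group. The subgroup $L$ is the kernel of the $G$-action on $G/H$; it is a closed normal subgroup of $G$ contained in $H$, and $H/L$ has the quotient topology. A closed subgroup $H$ of a locally compact group $G$ is topologically almost normal in $G$ if for every compact subset $K$ of $G$ there exists a compact subset $K'$ of $G$ such that $HK\subset K'H$. *)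

theory Defs
  imports "HOL-Analysis.Analysis" "HOL-Algebra.Coset" "HOL-Algebra.Left_Coset"
begin

section \<open>Topological groups\<close>

text \<open>Topological groups are Hausdorff by convention.\<close>

locale topological_group = group G for G (structure) +
  fixes T :: "'a topology"
  assumes topspace_eq: "topspace T = carrier G"
    and Hausdorff: "Hausdorff_space T"
    and continuous_mult: "continuous_map (prod_topology T T) T (\<lambda>(x, y). x \<otimes> y)"
    and continuous_inv: "continuous_map T T (\<lambda>x. inv x)"

section \<open>Quotient topologies\<close>

definition quotient_topology :: "'a topology \<Rightarrow> ('a \<Rightarrow> 'b) \<Rightarrow> 'b topology" where
  "quotient_topology X f =
     topology (\<lambda>V. V \<subseteq> f ` topspace X \<and> openin X {x \<in> topspace X. f x \<in> V})"

lemma openin_quotient_topology: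
  "openin (quotient_topology X f) V \<longleftrightarrow>
     V \<subseteq> f ` topspace X \<and> openin X {x \<in> topspace X. f x \<in> V}"
proof -
  have "istopology (\<lambda>V. V \<subseteq> f ` topspace X \<and> openin X {x \<in> topspace X. f x \<in> V})"
    unfolding istopology_def
  proof (intro conjI allI impI)
    fix S U
    assume S: "S \<subseteq> f ` topspace X \<and> openin X {x \<in> topspace X. f x \<in> S}"
      and U: "U \<subseteq> f ` topspace X \<and> openin X {x \<in> topspace X. f x \<in> U}"
    have "{x \<in> topspace X. f x \<in> S \<inter> U} =
        {x \<in> topspace X. f x \<in> S} \<inter> {x \<in> topspace X. f x \<in> U}" by blast
    then show "openin X {x \<in> topspace X. f x \<in> S \<inter> U}" using S U by auto
    show "S \<inter> U \<subseteq> f ` topspace X" using S by blast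
  next
    fix \<K>
    assume K: "\<forall>V\<in>\<K>. V \<subseteq> f ` topspace X \<and> openin X {x \<in> topspace X. f x \<in> V}"
    have "{x \<in> topspace X. f x \<in> \<Union>\<K>} = (\<Union>V\<in>\<K>. {x \<in> topspace X. f x \<in> V})" by blast
    then show "openin X {x \<in> topspace X. f x \<in> \<Union>\<K>}" using K by auto
    show "\<Union>\<K> \<subseteq> f ` topspace X" using K by blast
  qed
  then show ?thesis
    unfolding quotient_topology_def by (simp add: topology_inverse')
qed

lemma topspace_quotient_topology: "topspace (quotient_topology X f) = f ` topspace X"
proof
  show "topspace (quotient_topology X f) \<subseteq> f ` topspace X"
    using openin_quotient_topology openin_topspace by metis
  have "{x \<in> topspace X. f x \<in> f ` topspace X} = topspace X" by blast
  then have "openin (quotient_topology X f) (f ` topspace X)"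
    by (simp add: openin_quotient_topology)
  then show "f ` topspace X \<subseteq> topspace (quotient_topology X f)" by (rule openin_subset)
qed

lemma quotient_map_quotient_topology: "quotient_map X (quotient_topology X f) f"
  by (auto simp: quotient_map_def topspace_quotient_topology openin_quotient_topology)

definition coset_topology ::
    "('a, 'b) monoid_scheme \<Rightarrow> 'a topology \<Rightarrow> 'a set \<Rightarrow> 'a set topology" where
  "coset_topology G T H = quotient_topology T (\<lambda>g. g <#\<^bsub>G\<^esub> H)"

lemma topspace_coset_topology:
  "topspace T = carrier G \<Longrightarrow> topspace (coset_topology G T H) = lcosets\<^bsub>G\<^esub> H"
  by (auto simp: coset_topology_def topspace_quotient_topology LCOSETS_def)

text \<open>The library builds factor groups from right cosets; for a normal subgroup these are
  the left cosets.\<close>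

definition factor_group_topology ::
    "('a, 'b) monoid_scheme \<Rightarrow> 'a topology \<Rightarrow> 'a set \<Rightarrow> 'a set topology" where
  "factor_group_topology G T N = quotient_topology T (\<lambda>g. N #>\<^bsub>G\<^esub> g)"

lemma topspace_factor_group_topology:
  "topspace T = carrier G \<Longrightarrow> topspace (factor_group_topology G T N) = carrier (G Mod N)"
  by (auto simp: factor_group_topology_def topspace_quotient_topology FactGroup_def RCOSETS_def)

section \<open>Proper invariant metrics\<close>

definition proper_metric :: "'a set \<Rightarrow> ('a \<Rightarrow> 'a \<Rightarrow> real) \<Rightarrow> bool" where
  "proper_metric M d \<longleftrightarrow>
     (\<forall>x\<in>M. \<forall>r. compactin (Metric_space.mtopology M d) (Metric_space.mcball M d x r))"

definition invariant_metric ::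
    "('a, 'b) monoid_scheme \<Rightarrow> 'a set \<Rightarrow> ('a set \<Rightarrow> 'a set \<Rightarrow> real) \<Rightarrow> bool" where
  "invariant_metric G H d \<longleftrightarrow>
     (\<forall>g\<in>carrier G. \<forall>x\<in>lcosets\<^bsub>G\<^esub> H. \<forall>y\<in>lcosets\<^bsub>G\<^esub> H. d (g <#\<^bsub>G\<^esub> x) (g <#\<^bsub>G\<^esub> y) = d x y)"

section \<open>Relatively invariant Radon measures\<close>

definition radon_measure :: "'a topology \<Rightarrow> 'a measure \<Rightarrow> bool" where
  "radon_measure X M \<longleftrightarrow>
     space M = topspace X \<and>
     sets M = sigma_sets (topspace X) {U. openin X U} \<and>
     (\<forall>K. compactin X K \<longrightarrow> emeasure M K < \<infinity>) \<and>
     (\<forall>B\<in>sets M. emeasure M B = (INF U\<in>{U. openin X U \<and> B \<subseteq> U}. emeasure M U)) \<and>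
     (\<forall>U. openin X U \<longrightarrow> emeasure M U = (SUP K\<in>{K. compactin X K \<and> K \<subseteq> U}. emeasure M K))"

definition relatively_invariant_measure ::
    "('a, 'b) monoid_scheme \<Rightarrow> 'a topology \<Rightarrow> 'a set measure \<Rightarrow> bool" where
  "relatively_invariant_measure G T M \<longleftrightarrow>
     (\<exists>\<delta> :: 'a \<Rightarrow> real.
        continuous_map T (top_of_set {0<..}) \<delta> \<and>
        (\<forall>g\<in>carrier G. \<forall>h\<in>carrier G. \<delta> (g \<otimes>\<^bsub>G\<^esub> h) = \<delta> g * \<delta> h) \<and>
        (\<forall>g\<in>carrier G. \<forall>A\<in>sets M.
           emeasure M ((\<lambda>x. g <#\<^bsub>G\<^esub> x) ` A) = ennreal (\<delta> g) * emeasure M A))"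

section \<open>Maximal almost periodicity and topological almost normality\<close>

text \<open>The compact group may be sought on the type \<open>'a set set\<close> without loss of generality: it can be
  replaced by the closure of the image of \<open>G\<close>, and a Hausdorff space with a dense subset of
  cardinality \<open>\<kappa>\<close> has at most \<open>2 ^ (2 ^ \<kappa>)\<close> points.\<close>

definition maximally_almost_periodic ::
    "('a, 'b) monoid_scheme \<Rightarrow> 'a topology \<Rightarrow> bool" where
  "maximally_almost_periodic G T \<longleftrightarrow>
     (\<exists>(K :: 'a set set monoid) S \<phi>.
        topological_group K S \<and> compact_space S \<and>
        \<phi> \<in> hom G K \<and> continuous_map T S \<phi> \<and> inj_on \<phi> (carrier G))"

definition topologically_almost_normal ::
    "('a, 'b) monoid_scheme \<Rightarrow> 'a topology \<Rightarrow> 'a set \<Rightarrow> bool" where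
  "topologically_almost_normal G T H \<longleftrightarrow>
     (\<forall>K. compactin T K \<longrightarrow> (\<exists>K'. compactin T K' \<and> H <#>\<^bsub>G\<^esub> K \<subseteq> K' <#>\<^bsub>G\<^esub> H))"

end

theory Submission
  imports Defs
begin

text \<open>
  The group \<open>G\<close> acts on \<open>X = G/H\<close> by isometries, and transitively. All three assertions are read off
  from this isometric action on a proper metric space.

  \<^bold>\<open>The measure.\<close> A proper metric space whose isometries act transitively carries a non-zero Radon
  measure invariant under all isometries, so \<open>\<chi> = 1\<close> is a possible modulus. As in Haar's
  construction, let \<open>N\<^sub>\<epsilon>(K)\<close> be the least number of \<open>\<epsilon>\<close>-balls covering a compact set \<open>K\<close> and let \<open>B\<close>
  be a fixed closed unit ball. Transitivity bounds \<open>N\<^sub>\<epsilon>(K) / N\<^sub>\<epsilon>(B)\<close> by \<open>N\<^sub>1(K)\<close>, independently of \<open>\<epsilon>\<close>,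
  so by Tychonoff's theorem these ratios converge for all \<open>K\<close> at once along some filter finer than
  \<open>\<epsilon> \<longrightarrow> 0\<close> (\<open>simultaneous_limit_of_bounded\<close>). The limit is monotone, subadditive and isometry-invariant
  because each ratio is, and it is additive on disjoint compact sets because these lie at positive
  distance, so that no \<open>\<epsilon>\<close>-ball meets both once \<open>\<epsilon>\<close> is small
  (\<open>exists_isometry_invariant_content\<close>). Such a set function on compact sets extends to a Radon measure
  (\<open>radon_borel_extension\<close>), and the extension keeps its symmetries (\<open>borel_extension_invariant\<close>).

  \<^bold>\<open>Maximal almost periodicity.\<close> The isometries of \<open>X\<close> that fix the base point \<open>H\<close> form a compact group
  for pointwise convergence: such an isometry maps each \<open>x\<close> into the compact ball around the base point
  through \<open>x\<close>, which places it in a product of compact balls (\<open>compact_space_isotropy\<close>). The action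
  sends \<open>H\<close> into this group, and its kernel is \<open>L\<close>.

  \<^bold>\<open>Almost normality.\<close> For compact \<open>K\<close> the image of \<open>K\<close> in \<open>X\<close> lies in a closed ball around the base
  point. Since \<open>H\<close> fixes the base point and acts by isometries, the image of \<open>H K\<close> lies in the same
  ball. This ball is compact, hence covered by the image of a compact subset \<open>K'\<close> of \<open>G\<close>, which means
  \<open>H K \<subseteq> K' H\<close>.
\<close>

section \<open>From contents on compact sets to Radon measures\<close>

text \<open>Subadditivity is assumed on compact sets and needed on open sets; this splitting transfers it. The
  compact sets \<open>K - U\<close> and \<open>K - V\<close> are disjoint, and removing from \<open>K\<close> disjoint open neighbourhoods of
  the two leaves the two parts.\<close>

lemma compactin_split_two_open:
  assumes X: "Hausdorff_space X" and K: "compactin X K"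
    and U: "openin X U" and V: "openin X V" and sub: "K \<subseteq> U \<union> V"
  obtains K1 K2 where "compactin X K1" "compactin X K2" "K1 \<subseteq> U" "K2 \<subseteq> V" "K = K1 \<union> K2"
proof -
  have minus: "compactin X (K - W)" if "openin X W" for W
  proof -
    have "K - W = (topspace X - W) \<inter> K" using compactin_subset_topspace[OF K] by blast
    moreover have "closedin X (topspace X - W)" using that by blast
    ultimately show ?thesis using closed_Int_compactin K by metis
  qed
  have "disjnt (K - U) (K - V)"
    using sub by (auto simp: disjnt_def)
  then obtain U' V' where UV: "openin X U'" "openin X V'" "K - U \<subseteq> U'" "K - V \<subseteq> V'" "disjnt U' V'"
    using Hausdorff_space_compact_separation[OF X minus[OF U] minus[OF V]] by metis
  show thesis
  proof
    show "compactin X (K - U')" "compactin X (K - V')"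
      using minus UV by auto
    show "K - U' \<subseteq> U" "K - V' \<subseteq> V"
      using UV by auto
    show "K = K - U' \<union> (K - V')"
      using \<open>disjnt U' V'\<close> by (auto simp: disjnt_iff)
  qed
qed

text \<open>A content in the sense of Halmos. It need not be regular: the measure constructed from it may exceed
  it on a compact set.\<close>

locale compact_content =
  fixes X :: "'a topology" and lam :: "'a set \<Rightarrow> ennreal"
  assumes Hausdorff: "Hausdorff_space X"
    and locally_compact: "locally_compact_space X"
    and empty: "lam {} = 0"
    and finite: "compactin X K \<Longrightarrow> lam K < \<infinity>"
    and mono: "\<lbrakk>compactin X K; compactin X K'; K \<subseteq> K'\<rbrakk> \<Longrightarrow> lam K \<le> lam K'"
    and subadditive: "\<lbrakk>compactin X K; compactin X K'\<rbrakk> \<Longrightarrow> lam (K \<union> K') \<le> lam K + lam K'"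
    and additive: "\<lbrakk>compactin X K; compactin X K'; disjnt K K'\<rbrakk> \<Longrightarrow> lam (K \<union> K') = lam K + lam K'"
begin

definition inner :: "'a set \<Rightarrow> ennreal" where
  "inner U = (SUP K\<in>{K. compactin X K \<and> K \<subseteq> U}. lam K)"

definition outer :: "'a set \<Rightarrow> ennreal" where
  "outer A = (INF U\<in>{U. openin X U \<and> A \<subseteq> U}. inner U)"

lemma inner_upper: "compactin X K \<Longrightarrow> K \<subseteq> U \<Longrightarrow> lam K \<le> inner U"
  unfolding inner_def by (rule SUP_upper) auto

lemma inner_least: "(\<And>K. compactin X K \<Longrightarrow> K \<subseteq> U \<Longrightarrow> lam K \<le> c) \<Longrightarrow> inner U \<le> c"
  unfolding inner_def by (rule SUP_least) auto

lemma inner_mono: "U \<subseteq> V \<Longrightarrow> inner U \<le> inner V"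
  by (meson inner_least inner_upper order_trans)

lemma inner_empty: "inner {} = 0"
  using inner_least[of "{}" 0] empty by simp

lemma content_le_sum_inner:
  fixes U :: "nat \<Rightarrow> 'a set"
  assumes "\<And>i. openin X (U i)" "compactin X K" "K \<subseteq> (\<Union>i<n. U i)"
  shows "lam K \<le> (\<Sum>i<n. inner (U i))"
  using assms(2,3)
proof (induction n arbitrary: K)
  case 0
  then show ?case by (simp add: empty)
next
  case (Suc n)
  have op: "openin X (\<Union>i<n. U i)" using assms(1) by auto
  have "K \<subseteq> (\<Union>i<n. U i) \<union> U n"
    using Suc.prems(2) by (auto simp: lessThan_Suc)
  then obtain K1 K2 where K: "compactin X K1" "compactin X K2" "K1 \<subseteq> (\<Union>i<n. U i)" "K2 \<subseteq> U n" "K = K1 \<union> K2"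
    using compactin_split_two_open[OF Hausdorff Suc.prems(1) op assms(1)] by metis
  have "lam K \<le> lam K1 + lam K2"
    using K subadditive by simp
  also have "\<dots> \<le> (\<Sum>i<n. inner (U i)) + inner (U n)"
    using Suc.IH[of K1] K inner_upper by (intro add_mono) auto
  finally show ?case by simp
qed

lemma inner_UN_le:
  fixes U :: "nat \<Rightarrow> 'a set"
  assumes U: "\<And>i. openin X (U i)"
  shows "inner (\<Union>i. U i) \<le> (\<Sum>i. inner (U i))"
proof (rule inner_least)
  fix K assume K: "compactin X K" "K \<subseteq> (\<Union>i. U i)"
  then obtain \<F> where \<F>: "finite \<F>" "\<F> \<subseteq> range U" "K \<subseteq> \<Union>\<F>"
    using U unfolding compactin_def by (metis (no_types, lifting) imageE)
  then obtain I where I: "finite I" "\<F> = U ` I"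
    by (meson finite_subset_image)
  then obtain n where "I \<subseteq> {..<n}"
    using finite_nat_iff_bounded by blast
  then have "K \<subseteq> (\<Union>i<n. U i)"
    using \<F> I by blast
  then have "lam K \<le> (\<Sum>i<n. inner (U i))"
    using content_le_sum_inner U K by metis
  also have "\<dots> \<le> (\<Sum>i. inner (U i))"
    by (simp add: sum_le_suminf)
  finally show "lam K \<le> (\<Sum>i. inner (U i))" .
qed

lemma outer_lower: "openin X U \<Longrightarrow> A \<subseteq> U \<Longrightarrow> outer A \<le> inner U"
  unfolding outer_def by (rule INF_lower) auto

lemma outer_greatest: "(\<And>U. openin X U \<Longrightarrow> A \<subseteq> U \<Longrightarrow> c \<le> inner U) \<Longrightarrow> c \<le> outer A"
  unfolding outer_def by (rule INF_greatest) auto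

lemma outer_mono: "A \<subseteq> B \<Longrightarrow> outer A \<le> outer B"
  by (meson outer_greatest outer_lower order_trans)

lemma outer_open: "openin X U \<Longrightarrow> outer U = inner U"
  by (meson antisym inner_mono outer_greatest outer_lower order_refl)

text \<open>The converse inequality may fail, but this one suffices to recover the value of the measure on an
  open set from its compact subsets.\<close>

lemma content_le_outer: "compactin X K \<Longrightarrow> lam K \<le> outer K"
  by (simp add: inner_upper outer_greatest)

lemma outer_measure_space_outer: "outer_measure_space (Pow (topspace X)) outer"
  unfolding outer_measure_space_def
proof (intro conjI)
  show "positive (Pow (topspace X)) outer"
    using outer_open[of "{}"] by (simp add: positive_def inner_empty)
  show "increasing (Pow (topspace X)) outer"
    by (simp add: increasing_def outer_mono)
  show "countably_subadditive (Pow (topspace X)) outer"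
    unfolding countably_subadditive_def
  proof (intro allI impI)
    fix A :: "nat \<Rightarrow> 'a set"
    show "outer (\<Union>i. A i) \<le> (\<Sum>i. outer (A i))"
    proof (rule ennreal_le_epsilon)
      fix e :: real assume e: "0 < e" and top: "(\<Sum>i. outer (A i)) < Orderings.top"
      (* The i-th set is allowed the error e / 2^(i+1), so that the errors add up to e. *)
      have "\<exists>U. openin X U \<and> A i \<subseteq> U \<and> inner U \<le> outer (A i) + ennreal (e * (1/2) ^ Suc i)" for i
      proof -
        have "outer (A i) < Orderings.top"
          using top by (metis ennreal_suminf_lessD)
        then have "outer (A i) < outer (A i) + ennreal (e * (1/2) ^ Suc i)"
          using e by (simp add: ennreal_zero_less_mult_iff)
        then show ?thesis
          unfolding outer_def INF_less_iff by (auto intro: less_imp_le)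
      qed
      then obtain U where U: "\<And>i. openin X (U i)" "\<And>i. A i \<subseteq> U i"
          "\<And>i. inner (U i) \<le> outer (A i) + ennreal (e * (1/2) ^ Suc i)"
        by metis
      have "outer (\<Union>i. A i) \<le> inner (\<Union>i. U i)"
        using U by (intro outer_lower) auto
      also have "\<dots> \<le> (\<Sum>i. inner (U i))"
        by (intro inner_UN_le U)
      also have "\<dots> \<le> (\<Sum>i. outer (A i) + ennreal (e * (1/2) ^ Suc i))"
        by (intro suminf_le U) auto
      also have "\<dots> = (\<Sum>i. outer (A i)) + (\<Sum>i. ennreal (e * (1/2) ^ Suc i))"
        by (simp add: suminf_add)
      also have "(\<Sum>i. ennreal (e * (1/2) ^ Suc i)) = ennreal e"
      proof (rule suminf_ennreal_eq)
        show "0 \<le> e * (1/2) ^ Suc i" for i using e by simp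
        show "(\<lambda>i. e * (1/2) ^ Suc i) sums e"
          using sums_mult[OF power_half_series, of e] by simp
      qed
      finally show "outer (\<Union>i. A i) \<le> (\<Sum>i. outer (A i)) + ennreal e" .
    qed
  qed
qed

lemma outer_subadditive:
  assumes "A \<subseteq> topspace X" "B \<subseteq> topspace X"
  shows "outer (A \<union> B) \<le> outer A + outer B"
proof -
  interpret P: sigma_algebra "topspace X" "Pow (topspace X)" by (rule sigma_algebra_Pow)
  have "subadditive (Pow (topspace X)) outer"
    using outer_measure_space_outer P.countably_subadditive_subadditive
    by (simp add: outer_measure_space_def)
  then have "outer (A \<union> (B - A)) \<le> outer A + outer (B - A)"
    using assms by (intro subadditiveD) auto
  also have "\<dots> \<le> outer A + outer B"
    by (intro add_left_mono outer_mono) auto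
  finally show ?thesis by simp
qed

text \<open>Let \<open>V\<close> be an open superset of the test set. A compact \<open>K \<subseteq> V \<inter> U\<close> is closed, so \<open>V - K\<close> is open and
  contains \<open>V - U\<close>; each compact \<open>C \<subseteq> V - K\<close> is disjoint from \<open>K\<close>, so that additivity of the content
  bounds \<open>lam K + lam C\<close> by \<open>inner V\<close>. Taking the supremum first over \<open>C\<close> and then over \<open>K\<close> gives the
  inequality of Caratheodory's criterion that is not mere subadditivity.\<close>

lemma openin_lambda_system:
  assumes U: "openin X U"
  shows "U \<in> lambda_system (topspace X) (Pow (topspace X)) outer"
proof -
  interpret P: sigma_algebra "topspace X" "Pow (topspace X)" by (rule sigma_algebra_Pow)
  have split: "outer (A \<inter> U) + outer (A - U) \<le> outer A" for A
  proof (rule outer_greatest)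
    fix V assume V: "openin X V" "A \<subseteq> V"
    have one: "lam K + inner (V - K) \<le> inner V" if K: "compactin X K" "K \<subseteq> V" for K
    proof -
      have "lam K + inner (V - K) = (SUP C\<in>{C. compactin X C \<and> C \<subseteq> V - K}. lam K + lam C)"
        unfolding inner_def by (rule ennreal_SUP_add_right) (auto intro: exI[of _ "{}"])
      also have "\<dots> \<le> inner V"
      proof (rule SUP_least)
        fix C assume C: "C \<in> {C. compactin X C \<and> C \<subseteq> V - K}"
        then have "disjnt K C" by (auto simp: disjnt_iff)
        then have "lam K + lam C = lam (K \<union> C)"
          using K C additive by simp
        also have "\<dots> \<le> inner V"
          using K C by (intro inner_upper compactin_Un) auto
        finally show "lam K + lam C \<le> inner V" .
      qed
      finally show ?thesis .
    qed
    have two: "lam K + outer (V - U) \<le> inner V" if K: "compactin X K" "K \<subseteq> V \<inter> U" for K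
    proof -
      have "closedin X K" by (simp add: K Hausdorff compactin_imp_closedin)
      then have "outer (V - U) \<le> inner (V - K)"
        using K V by (intro outer_lower) (auto simp: openin_diff)
      then show ?thesis
        using one[of K] K by (meson add_left_mono le_inf_iff order_trans)
    qed
    have "outer (A \<inter> U) + outer (A - U) \<le> outer (V \<inter> U) + outer (V - U)"
      using V by (intro add_mono outer_mono) auto
    also have "\<dots> = inner (V \<inter> U) + outer (V - U)"
      using U V by (simp add: outer_open openin_Int)
    also have "\<dots> = (SUP K\<in>{K. compactin X K \<and> K \<subseteq> V \<inter> U}. lam K + outer (V - U))"
      unfolding inner_def by (rule ennreal_SUP_add_left[symmetric]) (auto intro: exI[of _ "{}"])
    also have "\<dots> \<le> inner V"
      using two by (intro SUP_least) auto
    finally show "outer (A \<inter> U) + outer (A - U) \<le> inner V" .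
  qed
  have "outer A \<le> outer (A \<inter> U) + outer (A - U)" if "A \<subseteq> topspace X" for A
    using outer_subadditive[of "A \<inter> U" "A - U"] that by (auto simp: Int_Diff_Un)
  then show ?thesis
    using split openin_subset[OF U] by (auto simp: P.lambda_system_eq intro: antisym)
qed

definition borel_extension :: "'a measure" where
  "borel_extension = measure_of (topspace X) {U. openin X U} outer"

lemma space_borel_extension: "space borel_extension = topspace X"
  using openin_subset by (auto simp: borel_extension_def space_measure_of_conv)

lemma sets_borel_extension:
  "sets borel_extension = sigma_sets (topspace X) {U. openin X U}"
  unfolding borel_extension_def by (rule sets_measure_of) (use openin_subset in auto)

lemma emeasure_borel_extension:
  assumes "A \<in> sigma_sets (topspace X) {U. openin X U}"
  shows "emeasure borel_extension A = outer A"
proof -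
  interpret P: sigma_algebra "topspace X" "Pow (topspace X)" by (rule sigma_algebra_Pow)
  let ?L = "lambda_system (topspace X) (Pow (topspace X)) outer"
  have ms: "measure_space (topspace X) ?L outer"
    by (rule P.caratheodory_lemma[OF outer_measure_space_outer])
  then interpret L: sigma_algebra "topspace X" ?L
    by (simp add: measure_space_def)
  have sub: "sigma_sets (topspace X) {U. openin X U} \<subseteq> ?L"
    using openin_lambda_system by (intro L.sigma_sets_subset) auto
  have pos: "positive (sets borel_extension) outer"
    using outer_measure_space_outer by (simp add: outer_measure_space_def positive_def)
  have "countably_additive ?L outer"
    using ms by (simp add: measure_space_def)
  then have ca: "countably_additive (sets borel_extension) outer"
    using sub unfolding countably_additive_def sets_borel_extension by (meson order_trans subsetD)
  show ?thesis
    by (rule emeasure_measure_of[OF borel_extension_def _ pos ca])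
      (use openin_subset assms sets_borel_extension in auto)
qed

lemma borel_openin: "openin X U \<Longrightarrow> U \<in> sigma_sets (topspace X) {U. openin X U}"
  by (simp add: sigma_sets.Basic)

lemma borel_compactin:
  assumes "compactin X K"
  shows "K \<in> sigma_sets (topspace X) {U. openin X U}"
proof -
  have "closedin X K" by (simp add: assms Hausdorff compactin_imp_closedin)
  then have "topspace X - (topspace X - K) \<in> sigma_sets (topspace X) {U. openin X U}"
    by (intro sigma_sets.Compl borel_openin) auto
  then show ?thesis
    by (simp add: assms compactin_subset_topspace double_diff)
qed

lemma outer_compact_finite:
  assumes K: "compactin X K"
  shows "outer K < \<infinity>"
proof -
  obtain U C where U: "openin X U" "compactin X C" "K \<subseteq> U" "U \<subseteq> C"
    using locally_compact_space_compact_closed_compact[of X] Hausdorff locally_compact K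
    by metis
  then have "outer K \<le> inner U" by (intro outer_lower)
  also have "\<dots> \<le> lam C"
    using U by (intro inner_least mono) auto
  also have "\<dots> < \<infinity>" by (rule finite[OF U(2)])
  finally show ?thesis .
qed

theorem radon_borel_extension: "radon_measure X borel_extension"
  unfolding radon_measure_def
proof (intro conjI ballI allI impI)
  show "space borel_extension = topspace X" by (rule space_borel_extension)
  show "sets borel_extension = sigma_sets (topspace X) {U. openin X U}" by (rule sets_borel_extension)
  show "emeasure borel_extension K < \<infinity>" if "compactin X K" for K
    using that by (simp add: emeasure_borel_extension borel_compactin outer_compact_finite[simplified])
  show "emeasure borel_extension B = (INF U\<in>{U. openin X U \<and> B \<subseteq> U}. emeasure borel_extension U)"
    if "B \<in> sets borel_extension" for B
    using that by (simp add: emeasure_borel_extension sets_borel_extension borel_openin outer_open)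
      (simp add: outer_def)
  show "emeasure borel_extension U = (SUP K\<in>{K. compactin X K \<and> K \<subseteq> U}. emeasure borel_extension K)"
    if U: "openin X U" for U
  proof -
    have "outer U = (SUP K\<in>{K. compactin X K \<and> K \<subseteq> U}. outer K)"
    proof (rule antisym)
      have "inner U \<le> (SUP K\<in>{K. compactin X K \<and> K \<subseteq> U}. outer K)"
        unfolding inner_def by (intro SUP_mono) (use content_le_outer in blast)
      then show "outer U \<le> (SUP K\<in>{K. compactin X K \<and> K \<subseteq> U}. outer K)"
        by (simp add: outer_open U)
      show "(SUP K\<in>{K. compactin X K \<and> K \<subseteq> U}. outer K) \<le> outer U"
        by (intro SUP_least) (auto intro: outer_mono)
    qed
    then show ?thesis
      by (simp add: emeasure_borel_extension borel_openin borel_compactin U)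
  qed
qed

lemma content_le_borel_extension: "compactin X K \<Longrightarrow> lam K \<le> emeasure borel_extension K"
  by (simp add: emeasure_borel_extension borel_compactin content_le_outer)

lemma homeomorphic_image_borel:
  assumes h: "homeomorphic_map X X h" and A: "A \<in> sigma_sets (topspace X) {U. openin X U}"
  shows "h ` A \<in> sigma_sets (topspace X) {U. openin X U}"
  using A
proof induction
  case (Basic U)
  then show ?case
    using homeomorphic_imp_open_map[OF h] by (auto simp: open_map_def intro: sigma_sets.Basic)
next
  case Empty
  then show ?case by (simp add: sigma_sets.Empty)
next
  case (Compl A)
  have "A \<subseteq> topspace X"
    using Compl.hyps sigma_sets_into_sp[of "{U. openin X U}" "topspace X"] openin_subset by blast
  then have "h ` (topspace X - A) = topspace X - h ` A"
    using homeomorphic_imp_injective_map[OF h] homeomorphic_imp_surjective_map[OF h]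
    by (metis Diff_subset inj_on_image_set_diff order_refl)
  then show ?case
    using Compl.IH by (simp add: sigma_sets.Compl)
next
  case (Union A)
  then show ?case
    by (simp add: image_UN sigma_sets.Union)
qed

lemma inner_image_ge:
  assumes h: "homeomorphic_map X X h" and inv: "\<And>K. compactin X K \<Longrightarrow> lam (h ` K) = lam K"
  shows "inner U \<le> inner (h ` U)"
proof (rule inner_least)
  fix K assume K: "compactin X K" "K \<subseteq> U"
  then have "compactin X (h ` K)"
    using h homeomorphic_imp_continuous_map image_compactin by blast
  then have "lam (h ` K) \<le> inner (h ` U)"
    using K by (intro inner_upper) auto
  then show "lam K \<le> inner (h ` U)" by (simp add: inv K)
qed

lemma outer_image_le:
  assumes h: "homeomorphic_map X X h" and inv: "\<And>K. compactin X K \<Longrightarrow> lam (h ` K) = lam K"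
    and A: "A \<subseteq> topspace X"
  shows "outer A \<le> outer (h ` A)"
proof (rule outer_greatest)
  fix U assume U: "openin X U" "h ` A \<subseteq> U"
  let ?V = "{x \<in> topspace X. h x \<in> U}"
  have "openin X ?V"
    using h U openin_continuous_map_preimage homeomorphic_imp_continuous_map by blast
  then have "outer A \<le> inner ?V"
    using A U by (intro outer_lower) auto
  also have "\<dots> \<le> inner (h ` ?V)" by (rule inner_image_ge[OF h inv])
  also have "\<dots> \<le> inner U" by (intro inner_mono) auto
  finally show "outer A \<le> inner U" .
qed

text \<open>The measure is obtained from the content and the topology by suprema and infima, all of which a
  content-preserving homeomorphism respects. The inequality from left to right is
  \<open>outer_image_le\<close> for the inverse homeomorphism.\<close>

theorem borel_extension_invariant:
  assumes h: "homeomorphic_map X X h" and inv: "\<And>K. compactin X K \<Longrightarrow> lam (h ` K) = lam K"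
    and A: "A \<in> sets borel_extension"
  shows "emeasure borel_extension (h ` A) = emeasure borel_extension A"
proof -
  have AX: "A \<subseteq> topspace X"
    using A sets.sets_into_space space_borel_extension by metis
  obtain g where g: "homeomorphic_maps X X h g"
    using h homeomorphic_map_maps by blast
  then have hg: "homeomorphic_map X X g"
    using homeomorphic_maps_map by blast
  have gh: "\<And>x. x \<in> topspace X \<Longrightarrow> g (h x) = x" "\<And>x. x \<in> topspace X \<Longrightarrow> h (g x) = x"
    using g by (auto simp: homeomorphic_maps_def)
  have him: "h ` A \<subseteq> topspace X"
    using AX homeomorphic_imp_surjective_map[OF h] by blast
  have ginv: "lam (g ` K) = lam K" if K: "compactin X K" for K
  proof -
    have "compactin X (g ` K)"
      using hg K homeomorphic_imp_continuous_map image_compactin by blast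
    then have "lam (h ` g ` K) = lam (g ` K)" by (rule inv)
    moreover have "h ` g ` K = K"
      using compactin_subset_topspace[OF K] gh by (force simp: image_image)
    ultimately show ?thesis by simp
  qed
  have "outer (h ` A) \<le> outer (g ` h ` A)"
    by (rule outer_image_le[OF hg ginv him])
  moreover have "g ` h ` A = A"
    using AX gh by (force simp: image_image)
  ultimately have "outer (h ` A) = outer A"
    using outer_image_le[OF h inv AX] by simp
  then show ?thesis
    using A homeomorphic_image_borel[OF h] by (simp add: emeasure_borel_extension sets_borel_extension)
qed

end

section \<open>Isometry-invariant measures on proper metric spaces\<close>

text \<open>A cluster point \<open>g\<close> of the sequence in the compact product of the intervals \<open>[-C i, C i]\<close> gives the
  filter: intersect the preimages of the neighbourhoods of \<open>g\<close> with the tails of the sequence. Passing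
  to a filter rather than to a subsequence allows an arbitrary index type.\<close>

lemma simultaneous_limit_of_bounded:
  fixes f :: "nat \<Rightarrow> 'i \<Rightarrow> real"
  assumes "\<And>n i. \<bar>f n i\<bar> \<le> C i"
  obtains F where "F \<le> sequentially" "F \<noteq> bot" "\<And>i. \<exists>l. ((\<lambda>n. f n i) \<longlongrightarrow> l) F"
proof -
  let ?S = "PiE UNIV (\<lambda>i. {- C i..C i})"
  have "compactin (product_topology (\<lambda>_. euclideanreal) UNIV) ?S"
    by (simp add: compactin_PiE)
  then have "compact ?S"
    by (simp add: euclidean_product_topology)
  moreover have "eventually (\<lambda>g. g \<in> ?S) (filtermap f sequentially)"
    using assms by (auto simp: eventually_filtermap abs_le_iff minus_le_iff PiE_iff)
  moreover have "filtermap f sequentially \<noteq> bot"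
    by (simp add: filtermap_bot_iff)
  ultimately obtain g where g: "inf (nhds g) (filtermap f sequentially) \<noteq> bot"
    unfolding compact_filter by blast
  define F where "F = inf (filtercomap f (nhds g)) sequentially"
  have "F \<noteq> bot"
  proof
    assume "F = bot"
    then obtain P Q where PQ: "eventually P (filtercomap f (nhds g))" "eventually Q sequentially"
        "\<And>n. \<not> (P n \<and> Q n)"
      unfolding F_def trivial_limit_def eventually_inf by auto
    then obtain R where R: "eventually R (nhds g)" "\<And>n. R (f n) \<Longrightarrow> P n"
      by (auto simp: eventually_filtercomap)
    have "eventually (\<lambda>h. \<not> R h) (filtermap f sequentially)"
      unfolding eventually_filtermap using PQ(2) by eventually_elim (use PQ R in blast)
    then have "eventually (\<lambda>h. False) (inf (nhds g) (filtermap f sequentially))"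
      unfolding eventually_inf using R(1) by blast
    then show False
      using g by (simp add: trivial_limit_def)
  qed
  moreover have "F \<le> sequentially" by (simp add: F_def)
  moreover have "\<exists>l. ((\<lambda>n. f n i) \<longlongrightarrow> l) F" for i
  proof -
    have "filterlim f (nhds g) F"
      unfolding F_def by (rule filterlim_mono[OF filterlim_filtercomap order_refl inf_le1])
    moreover have "((\<lambda>h. h i) \<longlongrightarrow> g i) (nhds g)"
    proof (rule topological_tendstoI)
      fix S :: "real set" assume S: "open S" "g i \<in> S"
      have "open ((\<lambda>h::'i \<Rightarrow> real. h i) -` S)"
        using continuous_on_product_coordinates S(1) by (rule open_vimage[rotated])
      then show "\<forall>\<^sub>F h in nhds g. h i \<in> S"
        using S unfolding eventually_nhds by (metis vimageI2 vimageD)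
    qed
    ultimately have "((\<lambda>n. f n i) \<longlongrightarrow> g i) F"
      using filterlim_compose by fastforce
    then show ?thesis by blast
  qed
  ultimately show thesis using that by blast
qed

context Metric_space
begin

definition isometric_bijection :: "('a \<Rightarrow> 'a) \<Rightarrow> bool" where
  "isometric_bijection h \<longleftrightarrow> h ` M = M \<and> (\<forall>x\<in>M. \<forall>y\<in>M. d (h x) (h y) = d x y)"

lemma isometric_bijection_closed: "isometric_bijection h \<Longrightarrow> x \<in> M \<Longrightarrow> h x \<in> M"
  by (auto simp: isometric_bijection_def)

lemma isometric_bijection_dist:
  "isometric_bijection h \<Longrightarrow> x \<in> M \<Longrightarrow> y \<in> M \<Longrightarrow> d (h x) (h y) = d x y"
  by (auto simp: isometric_bijection_def)

lemma isometric_bijection_inj: "isometric_bijection h \<Longrightarrow> inj_on h M"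
  unfolding isometric_bijection_def inj_on_def by (metis zero)

lemma isometric_bijection_inv:
  assumes "isometric_bijection h"
  shows "isometric_bijection (inv_into M h)"
  unfolding isometric_bijection_def
proof (intro conjI ballI)
  have im: "h ` M = M" and inj: "inj_on h M"
    using assms isometric_bijection_inj by (auto simp: isometric_bijection_def)
  show "inv_into M h ` M = M"
    using inv_into_image_cancel[OF inj, of M] im by simp
  fix x y assume "x \<in> M" "y \<in> M"
  then show "d (inv_into M h x) (inv_into M h y) = d x y"
    using assms im unfolding isometric_bijection_def by (metis f_inv_into_f inv_into_into)
qed

lemma isometric_bijection_homeomorphic_map:
  assumes "isometric_bijection h"
  shows "homeomorphic_map mtopology mtopology h"
proof -
  interpret MM: Metric_space12 M d M d ..
  show ?thesis
    using assms MM.isometry_imp_homeomorphic_map by (auto simp: isometric_bijection_def)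
qed

lemma compactin_isometric_image:
  "isometric_bijection h \<Longrightarrow> compactin mtopology K \<Longrightarrow> compactin mtopology (h ` K)"
  using isometric_bijection_homeomorphic_map homeomorphic_imp_continuous_map image_compactin by blast

text \<open>Centres may lie anywhere in the space, not only in the covered set; this makes the covering number
  monotone.\<close>

definition ball_cover :: "real \<Rightarrow> 'a set \<Rightarrow> 'a set \<Rightarrow> bool" where
  "ball_cover e A C \<longleftrightarrow> C \<subseteq> M \<and> finite C \<and> A \<subseteq> (\<Union>c\<in>C. mball c e)"

definition covering_number :: "real \<Rightarrow> 'a set \<Rightarrow> nat" where
  "covering_number e A = (INF C\<in>{C. ball_cover e A C}. card C)"

lemma covering_number_le: "ball_cover e A C \<Longrightarrow> covering_number e A \<le> card C"
  unfolding covering_number_def by (intro cINF_lower) auto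

lemma covering_number_attained:
  assumes "ball_cover e A C0"
  obtains C where "ball_cover e A C" "card C = covering_number e A"
proof -
  have "covering_number e A \<in> card ` {C. ball_cover e A C}"
    unfolding covering_number_def using assms by (intro Inf_nat_def1) auto
  then show thesis using that by auto
qed

lemma compactin_ball_cover:
  assumes "compactin mtopology K" "e > 0"
  obtains C where "ball_cover e K C"
  using compactin_imp_mtotally_bounded[OF assms(1)] assms compactin_subset_topspace[OF assms(1)]
  unfolding mtotally_bounded_def ball_cover_def by (metis subset_trans topspace_mtopology)

lemma covering_number_empty: "covering_number e {} = 0"
  using covering_number_le[of e "{}" "{}"] by (simp add: ball_cover_def)

lemma covering_number_mono:
  assumes "compactin mtopology K'" "e > 0" "K \<subseteq> K'"
  shows "covering_number e K \<le> covering_number e K'"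
proof -
  obtain C where C: "ball_cover e K' C" "card C = covering_number e K'"
    using assms compactin_ball_cover covering_number_attained by metis
  then have "ball_cover e K C" using assms(3) by (auto simp: ball_cover_def)
  then show ?thesis using covering_number_le C(2) by metis
qed

lemma covering_number_Un_le:
  assumes "compactin mtopology K" "compactin mtopology K'" "e > 0"
  shows "covering_number e (K \<union> K') \<le> covering_number e K + covering_number e K'"
proof -
  obtain C where C: "ball_cover e K C" "card C = covering_number e K"
    using assms compactin_ball_cover covering_number_attained by metis
  obtain C' where C': "ball_cover e K' C'" "card C' = covering_number e K'"
    using assms compactin_ball_cover covering_number_attained by metis
  have "ball_cover e (K \<union> K') (C \<union> C')" using C C' by (auto simp: ball_cover_def)
  then have "covering_number e (K \<union> K') \<le> card (C \<union> C')" by (rule covering_number_le)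
  also have "\<dots> \<le> card C + card C'" by (rule card_Un_le)
  finally show ?thesis using C C' by simp
qed

text \<open>No ball of radius \<open>e\<close> meets both sets, so an optimal cover of the union splits into covers of the
  two parts.\<close>

lemma covering_number_Un_separated:
  assumes K: "compactin mtopology K" and K': "compactin mtopology K'" and e: "e > 0"
    and sep: "\<And>x y. x \<in> K \<Longrightarrow> y \<in> K' \<Longrightarrow> 2 * e \<le> d x y"
  shows "covering_number e (K \<union> K') = covering_number e K + covering_number e K'"
proof (rule antisym)
  have KM: "K \<subseteq> M" "K' \<subseteq> M" using K K' compactin_subset_topspace by force+
  obtain C where C: "ball_cover e (K \<union> K') C" "card C = covering_number e (K \<union> K')"
    using compactin_Un[OF K K'] e compactin_ball_cover covering_number_attained by metis
  define C1 where "C1 = {c\<in>C. mball c e \<inter> K \<noteq> {}}"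
  define C2 where "C2 = {c\<in>C. mball c e \<inter> K' \<noteq> {}}"
  have fin: "finite C" using C by (simp add: ball_cover_def)
  have "ball_cover e K C1" "ball_cover e K' C2"
    using C(1) fin unfolding ball_cover_def C1_def C2_def by (simp; blast)+
  then have "covering_number e K + covering_number e K' \<le> card C1 + card C2"
    by (intro add_mono covering_number_le)
  also have "C1 \<inter> C2 = {}"
  proof (rule ccontr)
    assume "C1 \<inter> C2 \<noteq> {}"
    then obtain c x y where c: "c \<in> M" "x \<in> K" "y \<in> K'" "x \<in> M" "y \<in> M" "d c x < e" "d c y < e"
      by (auto simp: C1_def C2_def)
    then have "d x y < 2 * e"
      using triangle[of x c y] commute[of x c] by simp
    then show False using sep c by force
  qed
  then have "card C1 + card C2 = card (C1 \<union> C2)"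
    using fin by (subst card_Un_disjoint) (auto simp: C1_def C2_def)
  also have "\<dots> \<le> card C"
    using fin by (intro card_mono) (auto simp: C1_def C2_def)
  finally show "covering_number e K + covering_number e K' \<le> covering_number e (K \<union> K')"
    using C by simp
qed (rule covering_number_Un_le[OF K K' e])

lemma ball_cover_isometric_image:
  assumes "isometric_bijection h" "A \<subseteq> M" "ball_cover e A C"
  shows "ball_cover e (h ` A) (h ` C)"
  unfolding ball_cover_def
proof (intro conjI subsetI)
  show "finite (h ` C)" using assms by (simp add: ball_cover_def)
  show "x \<in> M" if "x \<in> h ` C" for x
    using that assms isometric_bijection_closed by (auto simp: ball_cover_def)
  fix y assume "y \<in> h ` A"
  then obtain x where x: "x \<in> A" "y = h x" by blast
  then obtain c where c: "c \<in> C" "c \<in> M" "x \<in> M" "d c x < e"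
    using assms by (auto simp: ball_cover_def)
  moreover have "h c \<in> M" "h x \<in> M"
    using c assms isometric_bijection_closed by auto
  ultimately show "y \<in> (\<Union>c\<in>h ` C. mball c e)"
    using assms x by (auto simp: isometric_bijection_dist)
qed

lemma covering_number_isometric_image_le:
  assumes "isometric_bijection h" "compactin mtopology K" "e > 0"
  shows "covering_number e (h ` K) \<le> covering_number e K"
proof -
  obtain C where C: "ball_cover e K C" "card C = covering_number e K"
    using assms compactin_ball_cover covering_number_attained by metis
  have "covering_number e (h ` K) \<le> card (h ` C)"
    using assms C compactin_subset_topspace by (intro covering_number_le ball_cover_isometric_image) force+
  also have "\<dots> \<le> card C" using C by (intro card_image_le) (simp add: ball_cover_def)
  finally show ?thesis using C by simp
qed

lemma covering_number_isometric_image: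
  assumes "isometric_bijection h" "compactin mtopology K" "e > 0"
  shows "covering_number e (h ` K) = covering_number e K"
proof (rule antisym)
  have "K \<subseteq> M" using assms(2) compactin_subset_topspace by force
  then have "inv_into M h ` h ` K = K"
    using isometric_bijection_inj[OF assms(1)] inv_into_image_cancel by metis
  moreover have "covering_number e (inv_into M h ` h ` K) \<le> covering_number e (h ` K)"
    using assms by (intro covering_number_isometric_image_le isometric_bijection_inv compactin_isometric_image)
  ultimately show "covering_number e K \<le> covering_number e (h ` K)" by simp
qed (rule covering_number_isometric_image_le[OF assms])

lemma isometric_bijection_image_mcball:
  assumes h: "isometric_bijection h" and x: "x \<in> M"
  shows "h ` mcball x r = mcball (h x) r"
proof
  show "h ` mcball x r \<subseteq> mcball (h x) r"
    using assms isometric_bijection_closed isometric_bijection_dist by auto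
  show "mcball (h x) r \<subseteq> h ` mcball x r"
  proof
    fix y assume y: "y \<in> mcball (h x) r"
    then have "y \<in> h ` M"
      using h by (simp add: isometric_bijection_def)
    then show "y \<in> h ` mcball x r"
      using y assms isometric_bijection_dist by auto
  qed
qed

text \<open>Cover \<open>K\<close> by balls of radius \<open>r\<close>, move each of them onto the reference ball by an isometry, and
  carry an optimal \<open>e\<close>-cover of the reference ball back. The factor \<open>covering_number r K\<close> does not depend
  on \<open>e\<close>, which keeps the normalised covering numbers bounded as \<open>e\<close> tends to \<open>0\<close>.\<close>

lemma covering_number_le_mult:
  assumes trans: "\<And>x y. x \<in> M \<Longrightarrow> y \<in> M \<Longrightarrow> \<exists>h. isometric_bijection h \<and> h x = y"
    and x0: "x0 \<in> M" and B: "compactin mtopology (mcball x0 r)"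
    and K: "compactin mtopology K" and e: "e > 0" and r: "r > 0"
  shows "covering_number e K \<le> covering_number r K * covering_number e (mcball x0 r)"
proof -
  obtain C where C: "ball_cover r K C" "card C = covering_number r K"
    using K r compactin_ball_cover covering_number_attained by metis
  obtain D where D: "ball_cover e (mcball x0 r) D" "card D = covering_number e (mcball x0 r)"
    using B e compactin_ball_cover covering_number_attained by metis
  have "\<forall>c\<in>C. \<exists>h. isometric_bijection h \<and> h x0 = c"
    using trans x0 C(1) by (auto simp: ball_cover_def)
  then obtain h where h: "\<And>c. c \<in> C \<Longrightarrow> isometric_bijection (h c)" "\<And>c. c \<in> C \<Longrightarrow> h c x0 = c"
    by metis
  have cov: "ball_cover e (mcball c r) (h c ` D)" if "c \<in> C" for c
    using ball_cover_isometric_image[OF h(1)[OF that] mcball_subset_mspace D(1)]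
      isometric_bijection_image_mcball[OF h(1)[OF that] x0] h(2)[OF that] by simp
  have "ball_cover e K (\<Union>c\<in>C. h c ` D)"
    unfolding ball_cover_def
  proof (intro conjI)
    show "(\<Union>c\<in>C. h c ` D) \<subseteq> M" using cov by (auto simp: ball_cover_def)
    show "finite (\<Union>c\<in>C. h c ` D)" using C D by (simp add: ball_cover_def)
    have "K \<subseteq> (\<Union>c\<in>C. mcball c r)"
    proof -
      have "(\<Union>c\<in>C. mball c r) \<subseteq> (\<Union>c\<in>C. mcball c r)"
        by (intro UN_mono mball_subset_mcball) auto
      then show ?thesis using C(1) unfolding ball_cover_def by (meson subset_trans)
    qed
    also have "\<dots> \<subseteq> (\<Union>c\<in>C. \<Union>x\<in>h c ` D. mball x e)"
      using cov unfolding ball_cover_def by (intro UN_mono) auto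
    also have "\<dots> = (\<Union>x\<in>(\<Union>c\<in>C. h c ` D). mball x e)" by blast
    finally show "K \<subseteq> (\<Union>x\<in>(\<Union>c\<in>C. h c ` D). mball x e)" .
  qed
  then have "covering_number e K \<le> card (\<Union>c\<in>C. h c ` D)" by (rule covering_number_le)
  also have "\<dots> \<le> (\<Sum>c\<in>C. card (h c ` D))"
    using C by (intro card_UN_le) (simp add: ball_cover_def)
  also have "\<dots> \<le> (\<Sum>c\<in>C. card D)"
    using D by (intro sum_mono card_image_le) (simp add: ball_cover_def)
  finally show ?thesis using C D by simp
qed

lemma covering_number_pos:
  assumes "compactin mtopology K" "e > 0" "K \<noteq> {}"
  shows "covering_number e K > 0"
proof -
  obtain C where C: "ball_cover e K C" "card C = covering_number e K"
    using assms compactin_ball_cover covering_number_attained by metis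
  then have "C \<noteq> {}" "finite C" using assms(3) by (auto simp: ball_cover_def)
  then show ?thesis using C(2) by (metis card_gt_0_iff)
qed

text \<open>The bound is a Lebesgue number of \<open>K\<close> for the cover consisting of the complement of \<open>K'\<close> alone.\<close>

lemma disjoint_compactin_separated:
  assumes K: "compactin mtopology K" and K': "compactin mtopology K'" and "disjnt K K'"
  obtains e where "e > 0" "\<And>x y. x \<in> K \<Longrightarrow> y \<in> K' \<Longrightarrow> e \<le> d x y"
proof -
  have KM: "K \<subseteq> M" "K' \<subseteq> M" using K K' compactin_subset_topspace by force+
  have "openin mtopology (M - K')"
    using compactin_imp_closedin[OF Hausdorff_space_mtopology K'] by (simp add: closedin_def)
  then have "\<exists>e>0. \<forall>x\<in>K. \<exists>U\<in>{M - K'}. mball x e \<subseteq> U"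
    using KM assms(3) by (intro lebesgue_number[OF K]) (auto simp: disjnt_iff)
  then obtain e where e: "e > 0" "\<And>x. x \<in> K \<Longrightarrow> mball x e \<subseteq> M - K'" by auto
  have "e \<le> d x y" if "x \<in> K" "y \<in> K'" for x y
  proof (rule ccontr)
    assume "\<not> e \<le> d x y"
    then have "y \<in> mball x e" using that KM by auto
    then show False using e(2)[OF that(1)] that(2) by blast
  qed
  then show thesis using that e(1) by blast
qed

text \<open>This is a limit of the ratios \<open>covering_number e K / covering_number e B\<close> as \<open>e\<close> tends to \<open>0\<close>, where \<open>B\<close>
  is a closed unit ball. Every property but additivity holds for each ratio and passes to the limit;
  additivity on disjoint compact sets holds as soon as \<open>2 * e\<close> is below their distance.\<close>

theorem exists_isometry_invariant_content:
  assumes x0: "x0 \<in> M" and proper: "proper_metric M d"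
    and trans: "\<And>x y. x \<in> M \<Longrightarrow> y \<in> M \<Longrightarrow> \<exists>h. isometric_bijection h \<and> h x = y"
  obtains lam where "compact_content mtopology lam" "lam (mcball x0 1) = 1"
    "\<And>h K. isometric_bijection h \<Longrightarrow> compactin mtopology K \<Longrightarrow> lam (h ` K) = lam K"
proof -
  let ?B = "mcball x0 1"
  have ball: "compactin mtopology (mcball x r)" if "x \<in> M" for x r
    using proper that by (simp add: proper_metric_def)
  have B: "compactin mtopology ?B" by (rule ball[OF x0])
  define e where "e n = 1 / (real n + 1)" for n
  have e: "e n > 0" for n by (simp add: e_def)
  have elim: "e \<longlonglongrightarrow> 0" unfolding e_def by (rule LIMSEQ_inverse_real_of_nat[unfolded inverse_eq_divide of_nat_Suc add.commute[of 1]]) 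
  define N where "N n K = real (covering_number (e n) K)" for n K
  have NB: "N n ?B > 0" for n
    unfolding N_def using covering_number_pos[OF B e] x0 centre_in_mcball_iff[of x0 1] by force
  (* The value 0 on sets that are not compact keeps the family bounded on every index. *)
  define f where "f n K = (if compactin mtopology K then N n K / N n ?B else 0)" for n K
  have bound: "\<bar>f n K\<bar> \<le> real (covering_number 1 K)" for n K
  proof (cases "compactin mtopology K")
    case True
    then have "N n K \<le> real (covering_number 1 K) * N n ?B"
      using covering_number_le_mult[OF trans x0 B True e[of n]]
      unfolding N_def of_nat_mult[symmetric] of_nat_le_iff by simp
    then show ?thesis
      using True NB[of n] by (simp add: f_def N_def divide_le_eq)
  qed (simp add: f_def)
  obtain F where F: "F \<le> sequentially" "F \<noteq> bot" "\<And>K. \<exists>l. ((\<lambda>n. f n K) \<longlongrightarrow> l) F"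
    using simultaneous_limit_of_bounded[of f, OF bound] by metis
  then obtain l where l: "\<And>K. ((\<lambda>n. f n K) \<longlongrightarrow> l K) F"
    by metis
  have f0: "f n K \<ge> 0" for n K by (simp add: f_def N_def)
  have l0: "l K \<ge> 0" for K
    using tendsto_lowerbound[OF l _ F(2)] f0 by simp
  have eqI: "l K = l'" if "\<And>n. f n K = f n K'" "l' = l K'" for K K' l'
    using tendsto_unique[OF F(2) l[of K]] l[of K'] that by simp
  show thesis
  proof
    show "ennreal (l ?B) = 1"
    proof -
      have "((\<lambda>n. f n ?B) \<longlongrightarrow> 1) F"
        using NB B by (simp add: f_def less_imp_neq[THEN not_sym])
      then show ?thesis using tendsto_unique[OF F(2) l] by simp
    qed
    show "ennreal (l (h ` K)) = ennreal (l K)" if "isometric_bijection h" "compactin mtopology K" for h K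
    proof -
      have "f n (h ` K) = f n K" for n
        using that e by (simp add: f_def N_def compactin_isometric_image covering_number_isometric_image)
      then show ?thesis using eqI by metis
    qed
    show "compact_content mtopology (\<lambda>K. ennreal (l K))"
    proof
      show "Hausdorff_space mtopology" by (rule Hausdorff_space_mtopology)
      show "locally_compact_space mtopology"
        unfolding locally_compact_space_def
      proof
        fix x assume "x \<in> topspace mtopology"
        then show "\<exists>U K. openin mtopology U \<and> compactin mtopology K \<and> x \<in> U \<and> U \<subseteq> K"
          using ball by (intro exI[of _ "mball x 1"] exI[of _ "mcball x 1"]) auto
      qed
      have "((\<lambda>n. f n {}) \<longlongrightarrow> 0) F" by (simp add: f_def N_def covering_number_empty)
      then show "ennreal (l {}) = 0" using tendsto_unique[OF F(2) l] by simp
      show "ennreal (l K) < \<infinity>" for K by simp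
      show "ennreal (l K) \<le> ennreal (l K')"
        if "compactin mtopology K" "compactin mtopology K'" "K \<subseteq> K'" for K K'
      proof (intro ennreal_leI tendsto_le[OF F(2) l l] always_eventually allI)
        show "f n K \<le> f n K'" for n
          using that covering_number_mono[OF that(2) e that(3)] NB[of n]
          by (simp add: f_def N_def divide_right_mono)
      qed
      show "ennreal (l (K \<union> K')) \<le> ennreal (l K) + ennreal (l K')"
        if KK: "compactin mtopology K" "compactin mtopology K'" for K K'
      proof -
        have "f n (K \<union> K') \<le> f n K + f n K'" for n
        proof -
          have "N n (K \<union> K') \<le> N n K + N n K'"
            using covering_number_Un_le[OF KK e, of n] unfolding N_def by linarith
          then show ?thesis
            using KK NB[of n] by (simp add: f_def compactin_Un divide_right_mono flip: add_divide_distrib)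
        qed
        then have "l (K \<union> K') \<le> l K + l K'"
          by (intro tendsto_le[OF F(2) tendsto_add[OF l l] l]) simp
        then show ?thesis using l0 by (simp flip: ennreal_plus)
      qed
      show "ennreal (l (K \<union> K')) = ennreal (l K) + ennreal (l K')"
        if KK: "compactin mtopology K" "compactin mtopology K'" "disjnt K K'" for K K'
      proof -
        obtain s where s: "s > 0" "\<And>x y. x \<in> K \<Longrightarrow> y \<in> K' \<Longrightarrow> s \<le> d x y"
          using disjoint_compactin_separated[OF KK] by metis
        have "eventually (\<lambda>n. e n < s / 2) sequentially"
          using order_tendstoD(2)[OF elim, of "s / 2"] s by simp
        then have "eventually (\<lambda>n. e n < s / 2) F"
          using F(1) filter_leD by blast
        then have "eventually (\<lambda>n. f n K + f n K' = f n (K \<union> K')) F"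
        proof eventually_elim
          case (elim n)
          have "covering_number (e n) (K \<union> K') = covering_number (e n) K + covering_number (e n) K'"
            using s(2) elim by (intro covering_number_Un_separated[OF KK(1,2) e]) fastforce
          then show ?case
            using KK by (simp add: f_def N_def compactin_Un add_divide_distrib)
        qed
        then have "((\<lambda>n. f n (K \<union> K')) \<longlongrightarrow> l K + l K') F"
          by (rule tendsto_cong[THEN iffD1]) (rule tendsto_add[OF l l])
        then have "l (K \<union> K') = l K + l K'" using tendsto_unique[OF F(2) l] by simp
        then show ?thesis using l0 by (simp flip: ennreal_plus)
      qed
    qed
  qed
qed

theorem exists_isometry_invariant_radon_measure:
  assumes x0: "x0 \<in> M" and proper: "proper_metric M d"
    and trans: "\<And>x y. x \<in> M \<Longrightarrow> y \<in> M \<Longrightarrow> \<exists>h. isometric_bijection h \<and> h x = y"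
  obtains \<mu> where "radon_measure mtopology \<mu>" "emeasure \<mu> (space \<mu>) \<noteq> 0"
    "\<And>h A. isometric_bijection h \<Longrightarrow> A \<in> sets \<mu> \<Longrightarrow> emeasure \<mu> (h ` A) = emeasure \<mu> A"
proof -
  obtain lam where lam: "compact_content mtopology lam" "lam (mcball x0 1) = 1"
    "\<And>h K. isometric_bijection h \<Longrightarrow> compactin mtopology K \<Longrightarrow> lam (h ` K) = lam K"
    using exists_isometry_invariant_content[OF assms] by metis
  interpret compact_content mtopology lam by (rule lam(1))
  have "compactin mtopology (mcball x0 1)"
    using proper x0 by (simp add: proper_metric_def)
  then have "1 \<le> emeasure borel_extension (mcball x0 1)"
    using content_le_borel_extension lam(2) by metis
  also have "\<dots> \<le> emeasure borel_extension (space borel_extension)"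
    by (rule emeasure_space)
  finally have "emeasure borel_extension (space borel_extension) \<noteq> 0" by auto
  then show thesis
    using that radon_borel_extension borel_extension_invariant[OF isometric_bijection_homeomorphic_map lam(3)]
    by blast
qed

end

section \<open>The compact group of isometries fixing a point\<close>

context Metric_space
begin

text \<open>Restricting maps to \<open>M\<close> by extensionality makes an isometry one element of the group and one point
  of the product over \<open>M\<close>.\<close>

definition isotropy_group :: "'a \<Rightarrow> ('a \<Rightarrow> 'a) monoid" where
  "isotropy_group x0 =
     \<lparr>carrier = {f \<in> extensional M. isometric_bijection f \<and> f x0 = x0},
      monoid.mult = compose M, one = (\<lambda>x\<in>M. x)\<rparr>"

definition isotropy_topology :: "'a \<Rightarrow> ('a \<Rightarrow> 'a) topology" where
  "isotropy_topology x0 =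
     subtopology (product_topology (\<lambda>_. mtopology) M) (carrier (isotropy_group x0))"

lemma isometric_bijection_compose:
  assumes "isometric_bijection f" "isometric_bijection g"
  shows "isometric_bijection (compose M f g)"
proof -
  have "compose M f g ` M = f ` g ` M"
    by (auto simp: compose_def image_image)
  then show ?thesis
    using assms isometric_bijection_closed[OF assms(2)] by (auto simp: isometric_bijection_def compose_def)
qed

lemma isometric_bijection_restrict:
  "isometric_bijection (restrict f M) \<longleftrightarrow> isometric_bijection f"
  by (simp add: isometric_bijection_def)

lemma group_isotropy_group:
  assumes x0: "x0 \<in> M"
  shows "group (isotropy_group x0)"
proof (rule groupI)
  let ?K = "isotropy_group x0"
  fix f assume f: "f \<in> carrier ?K"
  show "\<one>\<^bsub>?K\<^esub> \<otimes>\<^bsub>?K\<^esub> f = f"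
    using f by (auto simp: isotropy_group_def compose_def extensional_def isometric_bijection_closed)
  show "\<exists>g\<in>carrier ?K. g \<otimes>\<^bsub>?K\<^esub> f = \<one>\<^bsub>?K\<^esub>"
  proof
    have iso: "isometric_bijection f" and fx0: "f x0 = x0"
      using f by (auto simp: isotropy_group_def)
    show "restrict (inv_into M f) M \<in> carrier ?K"
      using isometric_bijection_inv[OF iso] inv_into_f_f[OF isometric_bijection_inj[OF iso] x0] fx0 x0
      by (simp add: isotropy_group_def isometric_bijection_restrict)
    show "restrict (inv_into M f) M \<otimes>\<^bsub>?K\<^esub> f = \<one>\<^bsub>?K\<^esub>"
      using inv_into_f_f[OF isometric_bijection_inj[OF iso]] isometric_bijection_closed[OF iso]
      by (auto simp: isotropy_group_def compose_def)
  qed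
  fix g assume g: "g \<in> carrier ?K"
  show "f \<otimes>\<^bsub>?K\<^esub> g \<in> carrier ?K"
    using f g x0 by (simp add: isotropy_group_def isometric_bijection_compose) (simp add: compose_def)
  fix h assume h: "h \<in> carrier ?K"
  show "f \<otimes>\<^bsub>?K\<^esub> g \<otimes>\<^bsub>?K\<^esub> h = f \<otimes>\<^bsub>?K\<^esub> (g \<otimes>\<^bsub>?K\<^esub> h)"
    using g h by (auto simp: isotropy_group_def compose_def isometric_bijection_closed)
next
  show "\<one>\<^bsub>isotropy_group x0\<^esub> \<in> carrier (isotropy_group x0)"
    using x0 by (simp add: isotropy_group_def isometric_bijection_def)
qed

lemma topspace_isotropy_topology: "topspace (isotropy_topology x0) = carrier (isotropy_group x0)"
proof -
  have "carrier (isotropy_group x0) \<subseteq> PiE M (\<lambda>_. M)"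
    by (simp add: isotropy_group_def PiE_iff subset_iff isometric_bijection_closed)
  then show ?thesis by (simp add: isotropy_topology_def Int_absorb1)
qed

lemma continuous_map_isotropy_eval:
  "x \<in> M \<Longrightarrow> continuous_map (isotropy_topology x0) mtopology (\<lambda>f. f x)"
  unfolding isotropy_topology_def
  by (intro continuous_map_from_subtopology continuous_map_product_projection)

lemma openin_isotropy_nhd:
  assumes "x \<in> M"
  shows "openin (isotropy_topology x0) {f \<in> carrier (isotropy_group x0). f x \<in> mball y e}"
  using openin_continuous_map_preimage[OF continuous_map_isotropy_eval[OF assms] openin_mball]
  by (simp add: topspace_isotropy_topology)

lemma continuous_map_into_isotropy:
  assumes "\<And>z. z \<in> topspace X \<Longrightarrow> F z \<in> carrier (isotropy_group x0)"
    and "\<And>x. x \<in> M \<Longrightarrow> continuous_map X mtopology (\<lambda>z. F z x)"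
  shows "continuous_map X (isotropy_topology x0) F"
  unfolding isotropy_topology_def continuous_map_in_subtopology continuous_map_componentwise
  using assms by (auto simp: isotropy_group_def)

lemma isotropy_groupD:
  assumes "f \<in> carrier (isotropy_group x0)"
  shows "isometric_bijection f" "f \<in> extensional M" "f x0 = x0" "\<And>x. x \<in> M \<Longrightarrow> f x \<in> M"
    "\<And>x y. x \<in> M \<Longrightarrow> y \<in> M \<Longrightarrow> d (f x) (f y) = d x y"
  using assms by (auto simp: isotropy_group_def isometric_bijection_closed isometric_bijection_dist)

lemma isotropy_group_inv:
  assumes x0: "x0 \<in> M" and f: "f \<in> carrier (isotropy_group x0)" and x: "x \<in> M"
  shows "f ((inv\<^bsub>isotropy_group x0\<^esub> f) x) = x"
proof -
  interpret K: group "isotropy_group x0" by (rule group_isotropy_group[OF x0])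
  have "(f \<otimes>\<^bsub>isotropy_group x0\<^esub> inv\<^bsub>isotropy_group x0\<^esub> f) x = \<one>\<^bsub>isotropy_group x0\<^esub> x"
    by (simp add: K.r_inv[OF f])
  then show ?thesis using x by (simp add: isotropy_group_def compose_def)
qed

text \<open>For isometries, pointwise convergence is enough to make composition jointly continuous: the error
  in the inner map is carried unchanged through the outer one. Inversion is continuous because
  \<open>f\<^sup>-\<^sup>1 x\<close> is at the same distance from \<open>y\<close> as \<open>x\<close> is from \<open>f y\<close>.\<close>

lemma topological_group_isotropy:
  assumes x0: "x0 \<in> M"
  shows "topological_group (isotropy_group x0) (isotropy_topology x0)"
proof -
  let ?K = "isotropy_group x0" and ?S = "isotropy_topology x0"
  interpret K: group ?K by (rule group_isotropy_group[OF x0])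
  show ?thesis
  proof (intro topological_group.intro topological_group_axioms.intro)
    show "group ?K" by (rule group_isotropy_group[OF x0])
    show "topspace ?S = carrier ?K" by (rule topspace_isotropy_topology)
    show "Hausdorff_space ?S"
      unfolding isotropy_topology_def
      by (intro Hausdorff_space_subtopology) (simp add: Hausdorff_space_product_topology Hausdorff_space_mtopology)
    show "continuous_map (prod_topology ?S ?S) ?S (\<lambda>(f, g). f \<otimes>\<^bsub>?K\<^esub> g)"
    proof (rule continuous_map_into_isotropy)
      fix z assume "z \<in> topspace (prod_topology ?S ?S)"
      then show "(case z of (f, g) \<Rightarrow> f \<otimes>\<^bsub>?K\<^esub> g) \<in> carrier ?K"
        by (auto simp: topspace_isotropy_topology)
    next
      fix x assume x: "x \<in> M"
      show "continuous_map (prod_topology ?S ?S) mtopology (\<lambda>z. (case z of (f, g) \<Rightarrow> f \<otimes>\<^bsub>?K\<^esub> g) x)"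
        unfolding continuous_map_to_metric
      proof (intro ballI allI impI)
        fix z and e :: real assume z: "z \<in> topspace (prod_topology ?S ?S)" and e: "e > 0"
        then obtain f0 g0 where z_eq: "z = (f0, g0)" and fg: "f0 \<in> carrier ?K" "g0 \<in> carrier ?K"
          by (auto simp: topspace_isotropy_topology)
        let ?U = "{f \<in> carrier ?K. f (g0 x) \<in> mball (f0 (g0 x)) (e/2)}
                  \<times> {g \<in> carrier ?K. g x \<in> mball (g0 x) (e/2)}"
        have g0x: "g0 x \<in> M" using fg x isotropy_groupD(4) by blast
        have "openin (prod_topology ?S ?S) ?U"
          unfolding openin_prod_Times_iff using openin_isotropy_nhd[OF g0x] openin_isotropy_nhd[OF x] by blast
        moreover have "z \<in> ?U"
          using z_eq fg e x g0x isotropy_groupD(4) by auto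
        moreover have "(case w of (f, g) \<Rightarrow> f \<otimes>\<^bsub>?K\<^esub> g) x \<in> mball ((case z of (f, g) \<Rightarrow> f \<otimes>\<^bsub>?K\<^esub> g) x) e"
          if w: "w \<in> ?U" for w
        proof -
          obtain f g where w_eq: "w = (f, g)" and f: "f \<in> carrier ?K" and g: "g \<in> carrier ?K"
            and fd: "d (f0 (g0 x)) (f (g0 x)) < e/2" and gd: "d (g0 x) (g x) < e/2"
            using w by auto
          have gx: "g x \<in> M" using g x isotropy_groupD(4) by blast
          (* Compare both with f (g0 x): the nearby outer map at the unperturbed inner point. *)
          have "d (f0 (g0 x)) (f (g x)) \<le> d (f0 (g0 x)) (f (g0 x)) + d (f (g0 x)) (f (g x))"
            by (intro triangle isotropy_groupD(4)[OF fg(1)] isotropy_groupD(4)[OF f] g0x gx)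
          also have "\<dots> < e"
            using fd gd isotropy_groupD(5)[OF f g0x gx] by simp
          finally show ?thesis
            using w_eq z_eq x gx g0x isotropy_groupD(4)[OF fg(1)] isotropy_groupD(4)[OF f]
            by (simp add: isotropy_group_def compose_def)
        qed
        ultimately show "\<exists>U. openin (prod_topology ?S ?S) U \<and> z \<in> U \<and>
            (\<forall>w\<in>U. (case w of (f, g) \<Rightarrow> f \<otimes>\<^bsub>?K\<^esub> g) x \<in> mball ((case z of (f, g) \<Rightarrow> f \<otimes>\<^bsub>?K\<^esub> g) x) e)"
          by blast
      qed
    qed
    show "continuous_map ?S ?S (\<lambda>f. inv\<^bsub>?K\<^esub> f)"
    proof (rule continuous_map_into_isotropy)
      show "inv\<^bsub>?K\<^esub> f \<in> carrier ?K" if "f \<in> topspace ?S" for f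
        using that by (simp add: topspace_isotropy_topology)
      fix x assume x: "x \<in> M"
      show "continuous_map ?S mtopology (\<lambda>f. (inv\<^bsub>?K\<^esub> f) x)"
        unfolding continuous_map_to_metric
      proof (intro ballI allI impI)
        fix f0 and e :: real assume "f0 \<in> topspace ?S" and e: "e > 0"
        then have f0: "f0 \<in> carrier ?K" by (simp add: topspace_isotropy_topology)
        define y where "y = (inv\<^bsub>?K\<^esub> f0) x"
        have y: "y \<in> M" "f0 y = x"
          unfolding y_def using isotropy_groupD(4)[OF K.inv_closed[OF f0] x] isotropy_group_inv[OF x0 f0 x] by auto
        let ?U = "{f \<in> carrier ?K. f y \<in> mball x e}"
        have "(inv\<^bsub>?K\<^esub> f) x \<in> mball y e" if f: "f \<in> ?U" for f
        proof -
          have fK: "f \<in> carrier ?K" and fy: "d x (f y) < e" using f by auto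
          have ix: "(inv\<^bsub>?K\<^esub> f) x \<in> M" by (rule isotropy_groupD(4)[OF K.inv_closed[OF fK] x])
          have "d y ((inv\<^bsub>?K\<^esub> f) x) = d (f y) (f ((inv\<^bsub>?K\<^esub> f) x))"
            using isotropy_groupD(5)[OF fK y(1) ix] by simp
          then have "d y ((inv\<^bsub>?K\<^esub> f) x) = d x (f y)"
            by (simp add: isotropy_group_inv[OF x0 fK x] commute)
          then show ?thesis using fy y ix by simp
        qed
        moreover have "f0 \<in> ?U" using f0 y x e by simp
        ultimately show "\<exists>U. openin ?S U \<and> f0 \<in> U \<and> (\<forall>f\<in>U. (inv\<^bsub>?K\<^esub> f) x \<in> mball ((inv\<^bsub>?K\<^esub> f0) x) e)"
          using openin_isotropy_nhd[OF y(1)] unfolding y_def[symmetric] by blast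
      qed
    qed
  qed
qed

text \<open>The relation forces \<open>g\<close> to be the inverse of \<open>f\<close>: put \<open>y = f x\<close>, respectively \<open>x = g y\<close>. It
  expresses bijectivity by conditions that survive pointwise limits.\<close>

lemma adjoint_pair_isometric:
  assumes f: "f \<in> M \<rightarrow> M" and g: "g \<in> M \<rightarrow> M"
    and adj: "\<And>x y. x \<in> M \<Longrightarrow> y \<in> M \<Longrightarrow> d (f x) y = d x (g y)"
  shows "isometric_bijection f"
  unfolding isometric_bijection_def
proof (intro conjI ballI)
  have fM: "f x \<in> M" and gM: "g x \<in> M" if "x \<in> M" for x using f g that by auto
  have gf: "g (f x) = x" if x: "x \<in> M" for x
    using adj[OF x fM[OF x]] x fM gM by (metis mdist_zero zero)
  have fg: "f (g y) = y" if y: "y \<in> M" for y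
    using adj[OF gM[OF y] y] y fM gM by (metis mdist_zero zero)
  have "y \<in> f ` M" if "y \<in> M" for y using fg[OF that, symmetric] gM[OF that] by (rule image_eqI)
  then show "f ` M = M" using fM by blast
  show "d (f x) (f y) = d x y" if "x \<in> M" "y \<in> M" for x y
    using adj[OF that(1) fM[OF that(2)]] gf[OF that(2)] by simp
qed

text \<open>A pointwise limit of bijections need not visibly be surjective, so the set of isometries is not
  exhibited as a closed set directly. Instead the pairs \<open>(f, f\<^sup>-\<^sup>1)\<close> are: they are the pairs satisfying the
  closed conditions \<open>d (f x) y = d x (g y)\<close> inside a square of a product of compact balls, and the group
  is the image of this compact set under the first projection. The ball belonging to \<open>x0\<close> itself has
  radius \<open>0\<close>, which makes \<open>x0\<close> a fixed point.\<close>

lemma compact_space_isotropy: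
  assumes x0: "x0 \<in> M" and proper: "proper_metric M d"
  shows "compact_space (isotropy_topology x0)"
proof -
  let ?X = "product_topology (\<lambda>_. mtopology) M"
  let ?XX = "prod_topology ?X ?X"
  define Q where "Q = PiE M (\<lambda>x. mcball x0 (d x0 x))"
  define D where "D x y = {p \<in> topspace ?XX. d (fst p x) y - d x (snd p y) = 0}" for x y
  define P where "P = (Q \<times> Q) \<inter> (\<Inter>p\<in>M \<times> M. D (fst p) (snd p))"
  have ball: "compactin mtopology (mcball x0 r)" for r
    using proper x0 by (simp add: proper_metric_def)
  have "compactin ?XX (Q \<times> Q)"
    unfolding compactin_Times Q_def compactin_PiE using ball by simp
  moreover have closed: "closedin ?XX (D x y)" if "x \<in> M" "y \<in> M" for x y
  proof -
    have 1: "continuous_map ?XX mtopology (\<lambda>p. fst p x)"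
      using continuous_map_compose[OF continuous_map_fst continuous_map_product_projection[OF that(1)]]
      by (simp add: o_def)
    have 2: "continuous_map ?XX mtopology (\<lambda>p. snd p y)"
      using continuous_map_compose[OF continuous_map_snd continuous_map_product_projection[OF that(2)]]
      by (simp add: o_def)
    have "continuous_map ?XX euclideanreal (\<lambda>p. d (fst p x) y)"
         "continuous_map ?XX euclideanreal (\<lambda>p. d x (snd p y))"
      using continuous_map_mdist[of ?XX "metric (M, d)" "\<lambda>p. fst p x" "\<lambda>_. y"]
        continuous_map_mdist[of ?XX "metric (M, d)" "\<lambda>_. x" "\<lambda>p. snd p y"] 1 2 that
      by (simp_all add: mtopology_of_def)
    then have "continuous_map ?XX euclideanreal (\<lambda>p. d (fst p x) y - d x (snd p y))"
      by (rule continuous_map_diff)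
    from closedin_continuous_map_preimage[OF this, of "{0}"] show ?thesis
      by (simp add: D_def)
  qed
  then have "closedin ?XX (\<Inter>p\<in>M \<times> M. D (fst p) (snd p))"
  proof (intro closedin_Inter)
    show "(\<lambda>p. D (fst p) (snd p)) ` (M \<times> M) \<noteq> {}" using x0 by blast
    fix E assume "E \<in> (\<lambda>p. D (fst p) (snd p)) ` (M \<times> M)"
    then obtain p where "p \<in> M \<times> M" and E: "E = D (fst p) (snd p)" by blast
    then show "closedin ?XX E" unfolding E by (intro closed) (simp_all add: mem_Times_iff)
  qed
  ultimately have "compactin ?XX P"
    unfolding P_def by (intro compact_Int_closedin)
  then have "compactin ?X (fst ` P)"
    by (rule image_compactin) (rule continuous_map_fst)
  moreover have "fst ` P = carrier (isotropy_group x0)"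
  proof
    show "fst ` P \<subseteq> carrier (isotropy_group x0)"
    proof
      fix f assume "f \<in> fst ` P"
      then obtain g where fg: "(f, g) \<in> P" by force
      then have fQ: "f \<in> Q" and gQ: "g \<in> Q" by (auto simp: P_def)
      have adj: "d (f x) y = d x (g y)" if "x \<in> M" "y \<in> M" for x y
        using fg that by (auto simp: P_def D_def)
      have "isometric_bijection f"
        using fQ gQ adj by (intro adjoint_pair_isometric[of f g]) (auto simp: Q_def PiE_iff)
      moreover have "f x0 \<in> mcball x0 (d x0 x0)"
        using fQ x0 by (auto simp: Q_def PiE_iff)
      then have "f x0 = x0"
        using x0 nonneg[of x0 "f x0"] by (auto simp: order_antisym_conv)
      ultimately show "f \<in> carrier (isotropy_group x0)"
        using fQ by (simp add: isotropy_group_def Q_def PiE_iff)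
    qed
    show "carrier (isotropy_group x0) \<subseteq> fst ` P"
    proof
      fix f assume f: "f \<in> carrier (isotropy_group x0)"
      let ?g = "inv\<^bsub>isotropy_group x0\<^esub> f"
      interpret K: group "isotropy_group x0" by (rule group_isotropy_group[OF x0])
      have g: "?g \<in> carrier (isotropy_group x0)" using f by simp
      have inQ: "h \<in> Q" if h: "h \<in> carrier (isotropy_group x0)" for h
      proof -
        have "d x0 (h x) = d x0 x" if "x \<in> M" for x
          using isotropy_groupD(5)[OF h x0 that] isotropy_groupD(3)[OF h] by simp
        then show ?thesis
          using x0 isotropy_groupD[OF h] by (simp add: Q_def PiE_iff)
      qed
      have "d (f x) y - d x (?g y) = 0" if "x \<in> M" "y \<in> M" for x y
        using isotropy_groupD(5)[OF f that(1) isotropy_groupD(4)[OF g that(2)]]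
          isotropy_group_inv[OF x0 f that(2)] by simp
      moreover have "(f, ?g) \<in> topspace ?XX"
        using isotropy_groupD[OF f] isotropy_groupD[OF g] by (simp add: PiE_iff)
      ultimately have "(f, ?g) \<in> P"
        using inQ[OF f] inQ[OF g] by (simp add: P_def D_def)
      then show "f \<in> fst ` P" by force
    qed
  qed
  ultimately show ?thesis
    by (simp add: isotropy_topology_def compact_space_subtopology)
qed

end

section \<open>Changing the carrier type of a compact group\<close>

lemma topological_group_transport:
  fixes e :: "'c \<Rightarrow> 'd"
  assumes K: "topological_group K S" and e: "inj_on e (carrier K)"
  obtains K' :: "'d monoid" and S' where "topological_group K' S'" "e \<in> hom K K'" "homeomorphic_map S S' e"
proof -
  interpret K: topological_group K S by (rule K)
  define i where "i = inv_into (carrier K) e"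
  define K' where "K' = \<lparr>carrier = e ` carrier K, monoid.mult = (\<lambda>x y. e (i x \<otimes>\<^bsub>K\<^esub> i y)), one = e \<one>\<^bsub>K\<^esub>\<rparr>"
  define S' where "S' = pullback_topology (e ` carrier K) i S"
  have ie: "i (e x) = x" if "x \<in> carrier K" for x
    using that e by (simp add: i_def)
  have ei: "e (i x) = x" if "x \<in> e ` carrier K" for x
    using that by (auto simp: ie)
  have hom: "e \<in> hom K K'"
    by (auto simp: hom_def K'_def ie)
  have "group (K'\<lparr>carrier := e ` carrier K, one := e \<one>\<^bsub>K\<^esub>\<rparr>)"
    by (rule K.hom_imp_img_group[OF hom])
  then have grp: "group K'" by (simp add: K'_def)
  then interpret K': group K' .
  have top: "topspace S' = e ` carrier K"
    by (auto simp: S'_def topspace_pullback_topology K.topspace_eq ie)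
  have ci: "continuous_map S' S i"
    using continuous_map_pullback[OF continuous_map_id[of S], where A = "e ` carrier K" and f = i]
    by (simp add: S'_def)
  have ce: "continuous_map S S' e"
    unfolding S'_def
  proof (rule continuous_map_pullback')
    show "continuous_map S S (i \<circ> e)"
      by (rule continuous_map_eq[OF continuous_map_id]) (simp add: ie K.topspace_eq)
  qed (auto simp: K.topspace_eq)
  have hm: "homeomorphic_maps S S' e i"
    using ci ce by (auto simp: homeomorphic_maps_def top K.topspace_eq ie)
  have "topological_group K' S'"
  proof (intro topological_group.intro topological_group_axioms.intro)
    show "group K'" by (rule grp)
    show "topspace S' = carrier K'" by (simp add: top K'_def)
    show "Hausdorff_space S'"
      using hm K.Hausdorff homeomorphic_Hausdorff_space homeomorphic_space_def by blast
    have "continuous_map (prod_topology S' S') (prod_topology S S) (\<lambda>(x, y). (i x, i y))"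
      using ci by (simp add: continuous_map_prod_top)
    then have "continuous_map (prod_topology S' S') S' (e \<circ> ((\<lambda>(x, y). x \<otimes>\<^bsub>K\<^esub> y) \<circ> (\<lambda>(x, y). (i x, i y))))"
      by (rule continuous_map_compose[OF continuous_map_compose[OF _ K.continuous_mult] ce])
    moreover have "e \<circ> ((\<lambda>(x, y). x \<otimes>\<^bsub>K\<^esub> y) \<circ> (\<lambda>(x, y). (i x, i y))) = (\<lambda>(x, y). x \<otimes>\<^bsub>K'\<^esub> y)"
      by (auto simp: K'_def)
    ultimately show "continuous_map (prod_topology S' S') S' (\<lambda>(x, y). x \<otimes>\<^bsub>K'\<^esub> y)" by simp
    have "continuous_map S' S' (e \<circ> ((\<lambda>x. inv\<^bsub>K\<^esub> x) \<circ> i))"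
      by (rule continuous_map_compose[OF continuous_map_compose[OF ci K.continuous_inv] ce])
    moreover have "(e \<circ> ((\<lambda>x. inv\<^bsub>K\<^esub> x) \<circ> i)) x = inv\<^bsub>K'\<^esub> x" if "x \<in> topspace S'" for x
    proof -
      have "x \<in> e ` carrier K" using that by (simp only: top)
      then obtain y where y: "y \<in> carrier K" "x = e y" by (elim imageE)
      have "inv\<^bsub>K'\<^esub> x = e (inv\<^bsub>K\<^esub> y)"
      proof (rule K'.inv_equality)
        show "e (inv\<^bsub>K\<^esub> y) \<otimes>\<^bsub>K'\<^esub> x = \<one>\<^bsub>K'\<^esub>" using y by (simp add: K'_def ie)
      qed (use y in \<open>simp_all add: K'_def\<close>)
      then show ?thesis using y ie by simp
    qed
    ultimately show "continuous_map S' S' (\<lambda>x. inv\<^bsub>K'\<^esub> x)"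
      by (rule continuous_map_eq)
  qed
  moreover have "homeomorphic_map S S' e" using hm homeomorphic_maps_map by blast
  ultimately show thesis using that hom by blast
qed

text \<open>The compact group may have any carrier type, as long as its elements can be coded injectively in the
  type fixed by the definition.\<close>

lemma maximally_almost_periodicI:
  fixes e :: "'c \<Rightarrow> 'a set set"
  assumes K: "topological_group K S" and comp: "compact_space S"
    and hom: "\<phi> \<in> hom G K" and cont: "continuous_map T S \<phi>" and inj: "inj_on \<phi> (carrier G)"
    and e: "inj_on e (carrier K)"
  shows "maximally_almost_periodic (G :: ('a, 'b) monoid_scheme) T"
proof -
  obtain K' :: "'a set set monoid" and S' where K': "topological_group K' S'" "e \<in> hom K K'" "homeomorphic_map S S' e"
    using topological_group_transport[OF K e] .
  have "compact_space S'"
    using comp K'(3) homeomorphic_compact_space homeomorphic_map_imp_homeomorphic_space by blast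
  moreover have "e \<circ> \<phi> \<in> hom G K'"
    using hom K'(2) by (rule hom_compose)
  moreover have "continuous_map T S' (e \<circ> \<phi>)"
    by (rule continuous_map_compose[OF cont homeomorphic_imp_continuous_map[OF K'(3)]])
  moreover have "inj_on (e \<circ> \<phi>) (carrier G)"
    using hom inj e by (intro comp_inj_on) (auto simp: hom_def intro: inj_on_subset)
  ultimately show ?thesis
    using K'(1) unfolding maximally_almost_periodic_def by blast
qed

section \<open>Coset spaces\<close>

text \<open>The images of relatively compact open sets form an open cover of \<open>C\<close>, and finitely many suffice.\<close>

lemma compactin_open_map_lift:
  assumes X: "locally_compact_space X" and open_map: "open_map X Y q"
    and C: "compactin Y C" and sub: "C \<subseteq> q ` topspace X"
  obtains K where "compactin X K" "C \<subseteq> q ` K"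
proof -
  obtain U K where UK: "\<And>x. x \<in> topspace X \<Longrightarrow> openin X (U x) \<and> compactin X (K x) \<and> x \<in> U x \<and> U x \<subseteq> K x"
    using X unfolding locally_compact_space_def by metis
  have "C \<subseteq> \<Union>((\<lambda>x. q ` U x) ` topspace X)"
    using sub UK by blast
  moreover have "openin Y V" if "V \<in> (\<lambda>x. q ` U x) ` topspace X" for V
    using that UK open_map by (auto simp: open_map_def)
  ultimately obtain \<F> where \<F>: "finite \<F>" "\<F> \<subseteq> (\<lambda>x. q ` U x) ` topspace X" "C \<subseteq> \<Union>\<F>"
    using C unfolding compactin_def by (metis (no_types, lifting))
  then obtain I where I: "finite I" "I \<subseteq> topspace X" "\<F> = (\<lambda>x. q ` U x) ` I"
    by (meson finite_subset_image)
  show thesis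
  proof
    show "compactin X (\<Union>(K ` I))"
      using I UK by (intro compactin_Union) auto
    have "q ` U x \<subseteq> q ` K x" if "x \<in> I" for x
      using UK I(2) that by (intro image_mono) blast
    then have "(\<Union>x\<in>I. q ` U x) \<subseteq> (\<Union>x\<in>I. q ` K x)" by (intro UN_mono) auto
    then show "C \<subseteq> q ` \<Union>(K ` I)"
      using \<F>(3) unfolding I(3) image_Union image_image by (rule order_trans[rotated])
  qed
qed

context group
begin

lemma lcosets_iff: "x \<in> lcosets H \<longleftrightarrow> (\<exists>a\<in>carrier G. x = a <# H)"
  by (auto simp: LCOSETS_def)

lemma lcos_eq_iff:
  assumes H: "subgroup H G" and a: "a \<in> carrier G" and b: "b \<in> carrier G"
  shows "a <# H = b <# H \<longleftrightarrow> inv a \<otimes> b \<in> H"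
proof
  assume "a <# H = b <# H"
  then have "b \<in> a <# H" using lcos_self[OF b H] by simp
  then show "inv a \<otimes> b \<in> H" using subgroup.lcos_module_imp[OF H group_axioms a] by simp
next
  assume "inv a \<otimes> b \<in> H"
  then have "b \<in> a <# H" using subgroup.lcos_module_rev[OF H group_axioms a b] by simp
  then show "a <# H = b <# H" using l_repr_independence[OF _ a H] by simp
qed

text \<open>The conjugates of \<open>H\<close> are the stabilisers of the points of the coset space; their intersection is
  therefore the kernel of the action.\<close>

lemma mem_conjugate_iff:
  assumes H: "subgroup H G" and a: "a \<in> carrier G" and g: "g \<in> carrier G"
  shows "g \<in> a <# H #> inv a \<longleftrightarrow> g <# (a <# H) = a <# H"
proof -
  have HG: "H \<subseteq> carrier G" using H by (rule subgroup.subset)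
  have "g \<in> a <# H #> inv a \<longleftrightarrow> inv a \<otimes> (g \<otimes> a) \<in> H"
  proof
    assume "g \<in> a <# H #> inv a"
    then obtain h where h: "h \<in> H" "g = a \<otimes> h \<otimes> inv a"
      by (auto simp: l_coset_def r_coset_def)
    then have "h \<in> carrier G" using HG by blast
    then have "inv a \<otimes> (g \<otimes> a) = h" using a h(2) by (simp add: m_assoc inv_solve_left')
    then show "inv a \<otimes> (g \<otimes> a) \<in> H" using h by simp
  next
    assume h: "inv a \<otimes> (g \<otimes> a) \<in> H"
    have "g = a \<otimes> (inv a \<otimes> (g \<otimes> a)) \<otimes> inv a"
      using a g by (simp add: m_assoc[symmetric]) (simp add: m_assoc)
    then show "g \<in> a <# H #> inv a"
      using h unfolding l_coset_def r_coset_def by blast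
  qed
  also have "\<dots> \<longleftrightarrow> a <# H = (g \<otimes> a) <# H"
    using lcos_eq_iff[OF H a, of "g \<otimes> a"] a g by simp
  also have "\<dots> \<longleftrightarrow> g <# (a <# H) = a <# H"
    using lcos_m_assoc[OF HG g a] by auto
  finally show ?thesis .
qed

end

context topological_group
begin

lemma continuous_map_right_translation:
  assumes "a \<in> carrier G"
  shows "continuous_map T T (\<lambda>g. g \<otimes> a)"
proof -
  have "continuous_map T (prod_topology T T) (\<lambda>g. (g, a))"
    using assms topspace_eq by (intro continuous_map_pairedI) auto
  from continuous_map_compose[OF this continuous_mult] show ?thesis by (simp add: o_def)
qed

lemma continuous_map_coset_translation:
  assumes H: "subgroup H G" and x: "x \<in> lcosets H"
  shows "continuous_map T (coset_topology G T H) (\<lambda>g. g <# x)"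
proof -
  obtain a where a: "a \<in> carrier G" "x = a <# H" using x unfolding lcosets_iff by blast
  have "continuous_map T (coset_topology G T H) ((\<lambda>g. g <# H) \<circ> (\<lambda>g. g \<otimes> a))"
    unfolding coset_topology_def
    by (rule continuous_map_compose[OF continuous_map_right_translation[OF a(1)]
          quotient_imp_continuous_map[OF quotient_map_quotient_topology]])
  then show ?thesis
    by (rule continuous_map_eq)
      (use a topspace_eq lcos_m_assoc[OF subgroup.subset[OF H]] in simp)
qed

text \<open>The saturation of an open set is the union of its right translates by elements of \<open>H\<close>.\<close>

lemma open_map_coset_projection:
  assumes H: "subgroup H G"
  shows "open_map T (coset_topology G T H) (\<lambda>g. g <# H)"
  unfolding open_map_def coset_topology_def openin_quotient_topology
proof (intro allI impI conjI)
  fix U assume U: "openin T U"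
  then have UG: "U \<subseteq> carrier G" using openin_subset topspace_eq by metis
  have HG: "H \<subseteq> carrier G" using H by (rule subgroup.subset)
  show "(\<lambda>g. g <# H) ` U \<subseteq> (\<lambda>g. g <# H) ` topspace T"
    using UG topspace_eq by blast
  have "{g \<in> topspace T. g <# H \<in> (\<lambda>g. g <# H) ` U} = (\<Union>h\<in>H. {g \<in> topspace T. g \<otimes> h \<in> U})"
  proof (intro subset_antisym subsetI)
    fix g assume "g \<in> {g \<in> topspace T. g <# H \<in> (\<lambda>g. g <# H) ` U}"
    then obtain u where g: "g \<in> carrier G" and u: "u \<in> U" "g <# H = u <# H"
      using topspace_eq by auto
    have uG: "u \<in> carrier G" using u UG by blast
    have "inv g \<otimes> u \<in> H" using lcos_eq_iff[OF H g uG] u by simp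
    moreover have "g \<otimes> (inv g \<otimes> u) = u" using g uG by (simp add: m_assoc[symmetric])
    ultimately show "g \<in> (\<Union>h\<in>H. {g \<in> topspace T. g \<otimes> h \<in> U})"
      using g u topspace_eq by (intro UN_I[of "inv g \<otimes> u"]) simp_all
  next
    fix g assume "g \<in> (\<Union>h\<in>H. {g \<in> topspace T. g \<otimes> h \<in> U})"
    then obtain h where h: "h \<in> H" and g: "g \<in> carrier G" and gh: "g \<otimes> h \<in> U"
      using topspace_eq by auto
    have hG: "h \<in> carrier G" using h HG by blast
    have "inv g \<otimes> (g \<otimes> h) \<in> H" using g hG h by (simp add: m_assoc[symmetric])
    then have "g <# H = (g \<otimes> h) <# H" using lcos_eq_iff[OF H g] g hG by simp
    then show "g \<in> {g \<in> topspace T. g <# H \<in> (\<lambda>g. g <# H) ` U}"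
      using g gh topspace_eq by blast
  qed
  moreover have "openin T {g \<in> topspace T. g \<otimes> h \<in> U}" if "h \<in> H" for h
    using openin_continuous_map_preimage[OF continuous_map_right_translation U] that HG by blast
  ultimately show "openin T {g \<in> topspace T. g <# H \<in> (\<lambda>g. g <# H) ` U}"
    by auto
qed

end

section \<open>Coset spaces with a proper invariant metric\<close>

locale proper_coset_space =
  topological_group G T + coset: Metric_space "lcosets\<^bsub>G\<^esub> H" d
  for G (structure) and T and H and d +
  assumes subgroup_H: "subgroup H G"
    and mtopology_eq: "coset.mtopology = coset_topology G T H"
    and proper: "proper_metric (lcosets H) d"
    and invariant: "invariant_metric G H d"
begin

lemma H_subset: "H \<subseteq> carrier G"
  using subgroup_H by (rule subgroup.subset)

lemma coset_subset: "x \<in> lcosets H \<Longrightarrow> x \<subseteq> carrier G"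
  using subgroup.lcosets_carrier[OF subgroup_H group_axioms] by blast

lemma act_closed: "g \<in> carrier G \<Longrightarrow> x \<in> lcosets H \<Longrightarrow> g <# x \<in> lcosets H"
  using lcos_m_assoc[OF H_subset] by (auto simp: lcosets_iff)

lemma act_mult:
  "g \<in> carrier G \<Longrightarrow> h \<in> carrier G \<Longrightarrow> x \<in> lcosets H \<Longrightarrow> g <# (h <# x) = (g \<otimes> h) <# x"
  using lcos_m_assoc[OF coset_subset] by blast

lemma act_one: "x \<in> lcosets H \<Longrightarrow> \<one> <# x = x"
  using lcos_mult_one[OF coset_subset] by blast

lemma H_coset: "H \<in> lcosets H"
  using lcos_mult_one[OF H_subset] by (auto simp: lcosets_iff intro!: bexI[of _ \<one>])

lemma act_isometric_bijection:
  assumes g: "g \<in> carrier G"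
  shows "coset.isometric_bijection (\<lambda>x. g <# x)"
  unfolding coset.isometric_bijection_def
proof (intro conjI subset_antisym subsetI)
  show "\<forall>x\<in>lcosets H. \<forall>y\<in>lcosets H. d (g <# x) (g <# y) = d x y"
    using invariant g by (simp add: invariant_metric_def)
  show "y \<in> lcosets H" if "y \<in> (\<lambda>x. g <# x) ` (lcosets H)" for y
    using that act_closed[OF g] by blast
  fix x assume x: "x \<in> lcosets H"
  have "x = g <# (inv g <# x)" using x g by (simp add: act_mult act_one)
  then show "x \<in> (\<lambda>x. g <# x) ` (lcosets H)" using act_closed[OF inv_closed[OF g] x] by (rule image_eqI)
qed

lemma act_transitive:
  assumes "x \<in> lcosets H" "y \<in> lcosets H"
  shows "\<exists>g\<in>carrier G. g <# x = y"
proof -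
  obtain a b where ab: "a \<in> carrier G" "x = a <# H" "b \<in> carrier G" "y = b <# H"
    using assms unfolding lcosets_iff by blast
  have "(b \<otimes> inv a) <# x = (b \<otimes> inv a \<otimes> a) <# H"
    using ab lcos_m_assoc[OF H_subset] by simp
  also have "\<dots> = y" using ab by (simp add: m_assoc)
  finally show ?thesis using ab by blast
qed

theorem exists_relatively_invariant_radon_measure:
  "\<exists>M. radon_measure (coset_topology G T H) M \<and> emeasure M (space M) \<noteq> 0 \<and>
       relatively_invariant_measure G T M"
proof -
  have trans: "\<exists>h. coset.isometric_bijection h \<and> h x = y" if "x \<in> lcosets H" "y \<in> lcosets H" for x y
    using act_transitive[OF that] act_isometric_bijection by blast
  obtain M where M: "radon_measure coset.mtopology M" "emeasure M (space M) \<noteq> 0"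
    "\<And>h A. coset.isometric_bijection h \<Longrightarrow> A \<in> sets M \<Longrightarrow> emeasure M (h ` A) = emeasure M A"
    using coset.exists_isometry_invariant_radon_measure[OF H_coset proper trans] by blast
  have "continuous_map T (top_of_set {0<..}) (\<lambda>_. 1 :: real)" by simp
  then have "relatively_invariant_measure G T M"
    unfolding relatively_invariant_measure_def
    using M(3)[OF act_isometric_bijection] by (intro exI[of _ "\<lambda>_. 1"]) simp
  then show ?thesis using M mtopology_eq by metis
qed

definition act :: "'a \<Rightarrow> 'a set \<Rightarrow> 'a set" where
  "act g = (\<lambda>x\<in>lcosets H. g <# x)"

lemma act_eq_iff:
  assumes g: "g \<in> carrier G" and h: "h \<in> carrier G"
  shows "act g = act h \<longleftrightarrow> inv g \<otimes> h \<in> (\<Inter>a\<in>carrier G. a <# H #> inv a)"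
proof -
  have "act g = act h \<longleftrightarrow> (\<forall>x\<in>lcosets H. g <# x = h <# x)"
    unfolding act_def by (metis restrict_apply' restrict_ext)
  also have "\<dots> \<longleftrightarrow> (\<forall>x\<in>lcosets H. (inv g \<otimes> h) <# x = x)"
  proof (intro ball_cong refl iffI)
    fix x assume x: "x \<in> lcosets H"
    show "(inv g \<otimes> h) <# x = x" if "g <# x = h <# x"
      using act_mult[OF inv_closed[OF g] h x] act_mult[OF inv_closed[OF g] g x] that g x
      by (simp add: act_one)
    show "g <# x = h <# x" if "(inv g \<otimes> h) <# x = x"
    proof -
      have "g <# x = (g \<otimes> (inv g \<otimes> h)) <# x"
        using act_mult[OF g, of "inv g \<otimes> h" x] that g h x by simp
      then show ?thesis using g h by (simp add: m_assoc[symmetric])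
    qed
  qed
  also have "\<dots> \<longleftrightarrow> (\<forall>a\<in>carrier G. (inv g \<otimes> h) <# (a <# H) = a <# H)"
    by (simp add: LCOSETS_def)
  also have "\<dots> \<longleftrightarrow> (\<forall>a\<in>carrier G. inv g \<otimes> h \<in> a <# H #> inv a)"
    using mem_conjugate_iff[OF subgroup_H _ m_closed[OF inv_closed[OF g] h]] by simp
  finally show ?thesis by simp
qed

lemma act_in_isotropy:
  assumes h: "h \<in> H"
  shows "act h \<in> carrier (coset.isotropy_group H)"
proof -
  have hG: "h \<in> carrier G" using h H_subset by blast
  have "h <# H = \<one> <# H"
    using lcos_eq_iff[OF subgroup_H hG one_closed] subgroup.m_inv_closed[OF subgroup_H h] hG by simp
  then have "h <# H = H" using lcos_mult_one[OF H_subset] by simp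
  then show ?thesis
    using act_isometric_bijection[OF hG] H_coset
    by (simp add: coset.isotropy_group_def act_def coset.isometric_bijection_restrict)
qed

lemma act_hom:
  assumes "g \<in> carrier G" "h \<in> carrier G"
  shows "act (g \<otimes> h) = act g \<otimes>\<^bsub>coset.isotropy_group H\<^esub> act h"
proof
  show "act (g \<otimes> h) x = (act g \<otimes>\<^bsub>coset.isotropy_group H\<^esub> act h) x" for x
    using assms by (cases "x \<in> lcosets H")
      (simp_all add: coset.isotropy_group_def act_def compose_def act_mult act_closed)
qed

lemma continuous_map_act:
  "continuous_map (subtopology T H) (coset.isotropy_topology H) act"
proof (rule coset.continuous_map_into_isotropy)
  show "act z \<in> carrier (coset.isotropy_group H)" if "z \<in> topspace (subtopology T H)" for z
    using that act_in_isotropy by simp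
  fix x assume x: "x \<in> lcosets H"
  have "continuous_map (subtopology T H) coset.mtopology (\<lambda>g. g <# x)"
    unfolding mtopology_eq
    by (rule continuous_map_from_subtopology[OF continuous_map_coset_translation[OF subgroup_H x]])
  then show "continuous_map (subtopology T H) coset.mtopology (\<lambda>z. act z x)"
    using x by (simp add: act_def)
qed

text \<open>The graph of a map between cosets, pulled back to pairs of group elements, with Kuratowski's
  encoding \<open>{{g}, {g, g'}}\<close> of pairs. Coding pairs of elements rather than pairs of cosets
  keeps the code within the third power set of the type of group elements.\<close>

definition graph_code :: "('a set \<Rightarrow> 'a set) \<Rightarrow> 'a set set set" where
  "graph_code f = {{{g}, {g, g'}} | g g'. g \<in> carrier G \<and> g' \<in> f (g <# H)}"

lemma inj_on_graph_code: "inj_on graph_code (extensional (lcosets H))"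
proof (rule inj_onI)
  fix f f' assume f: "f \<in> extensional (lcosets H)" "f' \<in> extensional (lcosets H)"
    and eq: "graph_code f = graph_code f'"
  have mem: "{{g}, {g, g'}} \<in> graph_code u \<longleftrightarrow> g' \<in> u (g <# H)" if "g \<in> carrier G" for g g' u
    using that by (auto simp: graph_code_def doubleton_eq_iff)
  show "f = f'"
  proof (rule extensionalityI[OF f])
    fix x assume "x \<in> lcosets H"
    then obtain g where g: "g \<in> carrier G" "x = g <# H" unfolding lcosets_iff by blast
    then show "f x = f' x" using mem[OF g(1), of _ f] mem[OF g(1), of _ f'] eq by blast
  qed
qed

text \<open>The action of \<open>H\<close> on the coset space is a continuous homomorphism into the compact isotropy group of
  the base point. It is constant exactly on the cosets of \<open>L\<close>, hence factors injectively through
  \<open>H/L\<close>.\<close>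

theorem maximally_almost_periodic_quotient:
  assumes L: "L = (\<Inter>a\<in>carrier G. a <# H #> inv a)"
  shows "maximally_almost_periodic (G\<lparr>carrier := H\<rparr> Mod L)
           (factor_group_topology (G\<lparr>carrier := H\<rparr>) (subtopology T H) L)"
proof -
  let ?Q = "G\<lparr>carrier := H\<rparr> Mod L"
  let ?K = "coset.isotropy_group H"
  (* All elements of a coset of L act alike, so it does not matter which one is chosen. *)
  define \<phi> where "\<phi> X = act (SOME h. h \<in> X)" for X
  have L_one: "\<one> \<in> L"
    unfolding L
  proof
    fix a assume a: "a \<in> carrier G"
    then have "a <# H \<in> lcosets H" by (auto simp: LCOSETS_def)
    then show "\<one> \<in> a <# H #> inv a" by (simp add: mem_conjugate_iff[OF subgroup_H a] act_one)
  qed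
  have LH: "L \<subseteq> H"
  proof
    fix l assume "l \<in> L"
    then have "l \<in> \<one> <# H #> inv \<one>" unfolding L by (rule INT_D) simp
    then have "l \<in> H #> \<one>" by (simp add: lcos_mult_one[OF H_subset])
    then show "l \<in> H" by (simp add: coset_mult_one[OF H_subset])
  qed
  have coset_act: "act z = act h" if h: "h \<in> H" and z: "z \<in> L #> h" for h z
  proof -
    obtain l where l: "l \<in> L" "z = l \<otimes> h" using z by (auto simp: r_coset_def)
    have lG: "l \<in> carrier G" "h \<in> carrier G" using l LH h H_subset by blast+
    have "act \<one> = act l" using act_eq_iff[OF one_closed lG(1)] l lG L by simp
    then have "act (l \<otimes> h) = act (\<one> \<otimes> h)" using lG by (simp only: act_hom one_closed)
    then show ?thesis using l lG by simp
  qed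
  have rcos: "L #>\<^bsub>G\<lparr>carrier := H\<rparr>\<^esub> h = L #> h" for h by (simp add: r_coset_def)
  have cosetE: "\<exists>h\<in>H. X = L #> h" if "X \<in> carrier ?Q" for X
    using that by (auto simp: FactGroup_def RCOSETS_def rcos)
  have self: "h \<in> L #> h" if "h \<in> H" for h
    using L_one that H_subset by (force simp: r_coset_def)
  have \<phi>: "\<phi> (L #> h) = act h" if "h \<in> H" for h
    unfolding \<phi>_def using coset_act[OF that] someI[of "\<lambda>z. z \<in> L #> h", OF self[OF that]] by simp
  show ?thesis
  proof (rule maximally_almost_periodicI)
    show "topological_group ?K (coset.isotropy_topology H)"
      by (rule coset.topological_group_isotropy[OF H_coset])
    show "compact_space (coset.isotropy_topology H)"
      by (rule coset.compact_space_isotropy[OF H_coset proper])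
    show "\<phi> \<in> hom ?Q ?K"
    proof (rule homI)
      show "\<phi> X \<in> carrier ?K" if "X \<in> carrier ?Q" for X
        using cosetE[OF that] \<phi> act_in_isotropy by auto
      fix X Y assume "X \<in> carrier ?Q" "Y \<in> carrier ?Q"
      then obtain h k where h: "h \<in> H" "X = L #> h" and k: "k \<in> H" "Y = L #> k"
        using cosetE by blast
      have XY: "X \<otimes>\<^bsub>?Q\<^esub> Y = X <#> Y" by (simp add: FactGroup_def set_mult_def)
      have G: "h \<in> carrier G" "k \<in> carrier G" using h k H_subset by blast+
      have "act z = act h \<otimes>\<^bsub>?K\<^esub> act k" if "z \<in> X <#> Y" for z
      proof -
        obtain x y where xy: "x \<in> X" "y \<in> Y" "z = x \<otimes> y" using \<open>z \<in> X <#> Y\<close> by (auto simp: set_mult_def)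
        have "x \<in> carrier G" "y \<in> carrier G"
          using xy h k LH H_subset G by (auto simp: r_coset_def)
        then show ?thesis using xy h k coset_act[OF h(1)] coset_act[OF k(1)] by (simp add: act_hom)
      qed
      moreover have "h \<otimes> k \<in> X <#> Y" using self h k by (auto simp: set_mult_def)
      ultimately have "\<phi> (X <#> Y) = act h \<otimes>\<^bsub>?K\<^esub> act k"
        unfolding \<phi>_def using someI[of "\<lambda>z. z \<in> X <#> Y"] by blast
      then show "\<phi> (X \<otimes>\<^bsub>?Q\<^esub> Y) = \<phi> X \<otimes>\<^bsub>?K\<^esub> \<phi> Y" using XY \<phi> h k by simp
    qed
    show "continuous_map (factor_group_topology (G\<lparr>carrier := H\<rparr>) (subtopology T H) L) (coset.isotropy_topology H) \<phi>"
      unfolding factor_group_topology_def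
    proof (rule continuous_compose_quotient_map[OF quotient_map_quotient_topology])
      show "continuous_map (subtopology T H) (coset.isotropy_topology H) (\<phi> \<circ> (\<lambda>g. L #>\<^bsub>G\<lparr>carrier := H\<rparr>\<^esub> g))"
        by (rule continuous_map_eq[OF continuous_map_act]) (simp add: rcos \<phi>)
    qed
    show "inj_on \<phi> (carrier ?Q)"
    proof (rule inj_onI)
      fix X Y assume "X \<in> carrier ?Q" "Y \<in> carrier ?Q" and eq: "\<phi> X = \<phi> Y"
      then obtain h k where h: "h \<in> H" "X = L #> h" and k: "k \<in> H" "Y = L #> k"
        using cosetE by blast
      have sub: "L #> a \<subseteq> L #> b" if ab: "a \<in> H" "b \<in> H" "act a = act b" for a b
      proof
        fix z assume z: "z \<in> L #> a"
        then have zH: "z \<in> H"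
          using ab LH subgroup.m_closed[OF subgroup_H] by (auto simp: r_coset_def)
        have G: "z \<in> carrier G" "b \<in> carrier G" using zH ab H_subset by blast+
        have "act z = act b" using coset_act[OF ab(1) z] ab by simp
        have "act (z \<otimes> inv b) = act b \<otimes>\<^bsub>?K\<^esub> act (inv b)" using G \<open>act z = act b\<close> by (simp add: act_hom)
        also have "\<dots> = act \<one>" using G by (simp flip: act_hom)
        finally have "z \<otimes> inv b \<in> L"
          using act_eq_iff[OF one_closed, of "z \<otimes> inv b"] G L by simp
        moreover have "z = z \<otimes> inv b \<otimes> b" using G by (simp add: m_assoc)
        ultimately show "z \<in> L #> b" unfolding r_coset_def by blast
      qed
      have "act h = act k" using eq \<phi> h k by simp
      then show "X = Y"
        unfolding h(2) k(2) using h(1) k(1) by (intro subset_antisym sub) simp_all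
    qed
    show "inj_on graph_code (carrier ?K)"
      by (rule inj_on_subset[OF inj_on_graph_code]) (auto simp: coset.isotropy_group_def)
  qed
qed

text \<open>The ball around the base point \<open>H\<close> that contains the image of \<open>K\<close> is invariant under \<open>H\<close>, so it also
  contains the image of \<open>H <#> K\<close>; being compact, it lifts to a compact subset of the group.\<close>

theorem topologically_almost_normal:
  assumes lc: "locally_compact_space T"
  shows "topologically_almost_normal G T H"
  unfolding topologically_almost_normal_def
proof (intro allI impI)
  fix K assume K: "compactin T K"
  have KG: "K \<subseteq> carrier G" using compactin_subset_topspace[OF K] topspace_eq by simp
  have "continuous_map T coset.mtopology (\<lambda>g. g <# H)"
    unfolding mtopology_eq by (rule continuous_map_coset_translation[OF subgroup_H H_coset])
  then have "compactin coset.mtopology ((\<lambda>g. g <# H) ` K)"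
    by (rule image_compactin[OF K])
  then have "coset.mbounded ((\<lambda>g. g <# H) ` K)"
    by (rule coset.compactin_imp_mbounded)
  then obtain x B where B: "(\<lambda>g. g <# H) ` K \<subseteq> coset.mcball x B"
    unfolding coset.mbounded_def by blast
  define r where "r = d x H + B"
  have r: "(\<lambda>g. g <# H) ` K \<subseteq> coset.mcball H r"
    using B coset.mcball_subset[of x H B r] H_coset by (simp add: r_def)
  have ball: "compactin (coset_topology G T H) (coset.mcball H r)"
    using proper H_coset unfolding proper_metric_def mtopology_eq by blast
  have "coset.mcball H r \<subseteq> (\<lambda>g. g <# H) ` topspace T"
    using coset.mcball_subset_mspace[of H r] unfolding topspace_eq LCOSETS_def by blast
  then obtain K' where K': "compactin T K'" "coset.mcball H r \<subseteq> (\<lambda>g. g <# H) ` K'"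
    using compactin_open_map_lift[OF lc open_map_coset_projection[OF subgroup_H] ball] by metis
  have K'G: "K' \<subseteq> carrier G" using compactin_subset_topspace[OF K'(1)] topspace_eq by simp
  have "H <#> K \<subseteq> K' <#> H"
  proof
    fix z assume "z \<in> H <#> K"
    then obtain h k where hk: "h \<in> H" "k \<in> K" "z = h \<otimes> k" by (auto simp: set_mult_def)
    have G: "h \<in> carrier G" "k \<in> carrier G" "z \<in> carrier G" using hk H_subset KG by auto
    have kb: "k <# H \<in> coset.mcball H r" using r hk by blast
    have "h <# H = H" using coset.isotropy_groupD(3)[OF act_in_isotropy[OF hk(1)]] H_coset by (simp add: act_def)
    then have "d H (h <# (k <# H)) = d H (k <# H)"
      using coset.isometric_bijection_dist[OF act_isometric_bijection[OF G(1)], of H "k <# H"] H_coset kb by simp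
    moreover have "h <# (k <# H) = z <# H" using hk G lcos_m_assoc[OF H_subset] by simp
    ultimately have "z <# H \<in> coset.mcball H r"
      using kb act_closed[OF G(3) H_coset] by simp
    then obtain k' where k': "k' \<in> K'" "z <# H = k' <# H" using K' by blast
    then have "z \<in> k' <# H" using lcos_self[OF G(3) subgroup_H] by simp
    then show "z \<in> K' <#> H" using k' by (auto simp: l_coset_def set_mult_def)
  qed
  then show "\<exists>K'. compactin T K' \<and> H <#> K \<subseteq> K' <#> H" using K' by blast
qed

end

section \<open>Consequences of a proper invariant metric\<close>

theorem proposition2p12:
  fixes G :: "('a, 'b) monoid_scheme" (structure)
    and T :: "'a topology" and H L :: "'a set"
  assumes "topological_group G T"
    and "second_countable T" and "locally_compact_space T"
    and "subgroup H G" and "closedin T H"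
    and "L = (\<Inter>g\<in>carrier G. g <# H #> inv g)"
    and "\<exists>d. Metric_space (lcosets H) d \<and>
             Metric_space.mtopology (lcosets H) d = coset_topology G T H \<and>
             proper_metric (lcosets H) d \<and> invariant_metric G H d"
  shows "(\<exists>M. radon_measure (coset_topology G T H) M \<and> emeasure M (space M) \<noteq> 0 \<and>
              relatively_invariant_measure G T M) \<and>
         maximally_almost_periodic (G\<lparr>carrier := H\<rparr> Mod L)
           (factor_group_topology (G\<lparr>carrier := H\<rparr>) (subtopology T H) L) \<and>
         topologically_almost_normal G T H"
proof -
  obtain d where d: "Metric_space (lcosets H) d" "Metric_space.mtopology (lcosets H) d = coset_topology G T H"
    "proper_metric (lcosets H) d" "invariant_metric G H d"
    using assms(7) by blast
  then interpret proper_coset_space G T H d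
    using assms(1,4) by (intro proper_coset_space.intro proper_coset_space_axioms.intro)
  show ?thesis
    using exists_relatively_invariant_radon_measure maximally_almost_periodic_quotient[OF assms(6)]
      topologically_almost_normal[OF assms(3)] by blast
qed

end
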